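(* Let $a\in L^1(I)$. For every $\lambda<\lambda_0^P$ and all $(t,s)\in(0,1)\times(0,1)$, $$G_P[\lambda](t,s)<G_D[\lambda](t,s)<0.$$
   Context: $I=[0,1]$, $a\in L^1(I)$ is real-valued, $\lambda\in\mathbb{R}$, and $L[\lambda]u(t)=u''(t)+(a(t)+\lambda)u(t)$. $W^{2,1}(I)=\{u\in C(I):u'\in AC(I)\}$, where $AC(I)$ is the set of absolutely continuous functions on $I$. $X_D=\{u\in W^{2,1}(I):u(0)=u(1)=0\}$ (Dirichlet) and $X_P=\{u\in W^{2,1}(I):u(0)=u(1),\,u'(0)=u'(1)\}$ (periodic). $L[\lambda]$ is nonresonant in $X$ if $u=0$ is the only $u\in X$ with $L[\lambda]u=0$ a.e. on $I$. In that case, for every $\sigma\in L^1(I)$ the problem $L[\lambda]u=\sigma$ a.e. on $I$, $u\in X$, has a unique solution, given by $u(t)=\int_0^1G(t,s)\sigma(s)\,ds$, where the continuous function $G:I\times I\to\mathbb{R}$ is the Green's function; it is denoted $G_D[\lambda]$ for $X=X_D$ and $G_P[\lambda]$ for $X=X_P$. $\lambda_0^P$ and $\lambda_0^D$ denote the first (smallest) eigenvalues of the periodic and Dirichlet problems, i.e. the smallest $\lambda$ for which $L[\lambda]u=0$ a.e. has a nontrivial solution in $X_P$, respectively $X_D$. It is known that $\lambda_0^P<\lambda_0^D$, so both Green's functions exist for $\lambda<\lambda_0^P$. *)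

theory Defs
  imports "HOL-Analysis.Analysis"
begin

text \<open>
  Functions on \<open>I01\<close>, the unit interval, are represented by functions \<open>real \<Rightarrow> real\<close>; none of the notions
  below depends on their values outside \<open>I01\<close>.
\<close>

abbreviation I01 :: "real set" where
  "I01 \<equiv> {0..1}"

definition abs_continuous_on :: "real set \<Rightarrow> (real \<Rightarrow> real) \<Rightarrow> bool" where
  "abs_continuous_on S f \<longleftrightarrow>
    (\<forall>\<epsilon>>0. \<exists>\<delta>>0. \<forall>P :: (real \<times> real) set.
      finite P \<longrightarrow>
      (\<forall>(x, y)\<in>P. x \<le> y \<and> {x..y} \<subseteq> S) \<longrightarrow>
      disjoint_family_on (\<lambda>(x, y). {x<..<y}) P \<longrightarrow>
      (\<Sum>(x, y)\<in>P. y - x) < \<delta> \<longrightarrow>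
      (\<Sum>(x, y)\<in>P. \<bar>f y - f x\<bar>) < \<epsilon>)"

text \<open>The derivative relative to \<open>I01\<close>, hence one-sided at \<open>0\<close> and \<open>1\<close>. It is an unspecified value
  at points of non-differentiability.\<close>

definition deriv_I :: "(real \<Rightarrow> real) \<Rightarrow> real \<Rightarrow> real" where
  "deriv_I u t = vector_derivative u (at t within I01)"

definition W21 :: "(real \<Rightarrow> real) set" where
  "W21 = {u. continuous_on I01 u \<and> u differentiable_on I01 \<and> abs_continuous_on I01 (deriv_I u)}"

definition X_D :: "(real \<Rightarrow> real) set" where
  "X_D = {u \<in> W21. u 0 = 0 \<and> u 1 = 0}"

definition X_P :: "(real \<Rightarrow> real) set" where
  "X_P = {u \<in> W21. u 0 = u 1 \<and> deriv_I u 0 = deriv_I u 1}"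

definition L_op :: "(real \<Rightarrow> real) \<Rightarrow> real \<Rightarrow> (real \<Rightarrow> real) \<Rightarrow> real \<Rightarrow> real" where
  "L_op a lam u t = deriv_I (deriv_I u) t + (a t + lam) * u t"

text \<open>\<open>L[lam]u = \<sigma>\<close> a.e. on \<open>I01\<close>. Differentiability of \<open>u'\<close> is stated because \<^const>\<open>deriv_I\<close> is
  total; it holds at almost every point as soon as \<open>u'\<close> is absolutely continuous.\<close>

definition L_eq_ae :: "(real \<Rightarrow> real) \<Rightarrow> real \<Rightarrow> (real \<Rightarrow> real) \<Rightarrow> (real \<Rightarrow> real) \<Rightarrow> bool" where
  "L_eq_ae a lam u \<sigma> \<longleftrightarrow>
    (AE t in lebesgue_on I01. deriv_I u differentiable (at t within I01) \<and> L_op a lam u t = \<sigma> t)"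

definition nonresonant :: "(real \<Rightarrow> real) \<Rightarrow> real \<Rightarrow> (real \<Rightarrow> real) set \<Rightarrow> bool" where
  "nonresonant a lam X \<longleftrightarrow> (\<forall>u\<in>X. L_eq_ae a lam u (\<lambda>_. 0) \<longrightarrow> (\<forall>t\<in>I01. u t = 0))"

definition is_eigenvalue :: "(real \<Rightarrow> real) \<Rightarrow> (real \<Rightarrow> real) set \<Rightarrow> real \<Rightarrow> bool" where
  "is_eigenvalue a X lam \<longleftrightarrow> (\<exists>u\<in>X. L_eq_ae a lam u (\<lambda>_. 0) \<and> (\<exists>t\<in>I01. u t \<noteq> 0))"

definition is_first_eigenvalue :: "(real \<Rightarrow> real) \<Rightarrow> (real \<Rightarrow> real) set \<Rightarrow> real \<Rightarrow> bool" where
  "is_first_eigenvalue a X lam0 \<longleftrightarrow>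
    is_eigenvalue a X lam0 \<and> (\<forall>\<mu>. is_eigenvalue a X \<mu> \<longrightarrow> lam0 \<le> \<mu>)"

text \<open>Solutions being unique on \<open>I01\<close> by nonresonance, the last conjunct says that for every
  \<open>\<sigma> \<in> L\<^sup>1(I01)\<close> the unique solution is \<open>\<integral>\<^sub>0\<^sup>1 G(t,s) \<sigma>(s) ds\<close>. Together with continuity this
  determines \<open>G\<close> on \<open>I01 \<times> I01\<close>.\<close>

definition is_Green_function ::
  "(real \<Rightarrow> real) \<Rightarrow> real \<Rightarrow> (real \<Rightarrow> real) set \<Rightarrow> (real \<Rightarrow> real \<Rightarrow> real) \<Rightarrow> bool" where
  "is_Green_function a lam X G \<longleftrightarrow>
    nonresonant a lam X \<and>
    continuous_on (I01 \<times> I01) (\<lambda>(t, s). G t s) \<and>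
    (\<forall>\<sigma>. \<sigma> absolutely_integrable_on I01 \<longrightarrow>
      (let u = (\<lambda>t. LINT s:I01|lebesgue. G t s * \<sigma> s)
       in u \<in> X \<and> L_eq_ae a lam u \<sigma>))"

end

theory Submission
  imports Defs
begin

text \<open>
  Write \<open>q = a + \<lambda>\<close>. Let \<open>\<phi>\<close>, \<open>\<psi>\<close> be the solutions of \<open>u'' + q u = 0\<close> with initial data \<open>(1, 0)\<close>
  and \<open>(0, 1)\<close>, let \<open>\<eta>\<close> be the solution with \<open>\<eta>(1) = 0\<close>, \<open>\<eta>'(1) = -1\<close>, and let
  \<open>\<Delta> = \<phi>(1) + \<psi>'(1)\<close> be Hill's discriminant. Suppose that \<open>\<psi> > 0\<close> on \<open>(0, 1]\<close> and \<open>\<Delta> > 2\<close>.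
  The Wronskian then gives \<open>\<eta> > 0\<close> on \<open>[0, 1)\<close>, and
    \<open>G\<^sub>D(t, s) = - \<eta>(max t s) \<psi>(min t s) / \<psi>(1)\<close>
  is negative on the open square. Let \<open>h = (\<psi> + \<eta>) / \<psi>(1) > 0\<close>, the homogeneous solution that is \<open>1\<close>
  at both ends. Matching the slopes at the ends gives
    \<open>G\<^sub>P(t, s) = G\<^sub>D(t, s) - h(t) h(s) / (h'(1) - h'(0))\<close>
  with \<open>h'(1) - h'(0) = (\<Delta> - 2) / \<psi>(1) > 0\<close>, and the claim follows
  (\<open>Green_functions_ordered\<close>).

  The two properties \<open>\<psi> > 0\<close> and \<open>\<Delta> > 2\<close> hold for very negative \<open>\<lambda>\<close> by an energy identity
  (\<open>quasi_derivative_energy\<close>), and they persist while \<open>\<lambda>\<close> increases through values below the first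
  periodic eigenvalue. Indeed \<open>\<Delta> = 2\<close> would make \<open>\<lambda>\<close> a periodic eigenvalue. If \<open>\<psi>\<close> lost its
  positivity, then at the first such \<open>\<lambda>\<close> its zero would be at \<open>t = 1\<close>, with \<open>\<psi>'(1) < 0\<close> and, by
  the Wronskian, \<open>\<phi>(1) = 1 / \<psi>'(1) < 0\<close>. Hence \<open>\<Delta> < 0\<close> there, a contradiction
  (\<open>positive_system_below_periodic_eigenvalues\<close>).

  As \<open>a\<close> is only integrable, two pieces of analysis carry this. Solutions that depend continuously on
  \<open>(\<lambda>, t)\<close> come from a contraction in a weighted sup norm (\<open>volterra_solution_exists\<close>). Solutions of
  the integrated equation satisfy the equation almost everywhere by Lebesgue's differentiation theorem
  in one dimension (\<open>primitive_AE_derivative\<close>).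
\<close>

section \<open>Indefinite integrals on the unit interval\<close>

text \<open>The pair of an absolutely continuous function and its density, in the form in which such
  functions are produced here: as indefinite integrals.\<close>

definition primitive :: "(real \<Rightarrow> real) \<Rightarrow> (real \<Rightarrow> real) \<Rightarrow> bool" where
  "primitive F f \<longleftrightarrow>
     f absolutely_integrable_on I01 \<and> (\<forall>t\<in>I01. F t = F 0 + integral {0..t} f)"

lemma primitive_density: "primitive F f \<Longrightarrow> f absolutely_integrable_on I01"
  by (simp only: primitive_def)

lemma primitive_eq: "primitive F f \<Longrightarrow> t \<in> I01 \<Longrightarrow> F t = F 0 + integral {0..t} f"
  by (simp only: primitive_def)

lemma abs_int_subinterval:
  fixes f :: "real \<Rightarrow> real"
  assumes "f absolutely_integrable_on I01" "0 \<le> x" "y \<le> 1"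
  shows "f absolutely_integrable_on {x..y}"
  using absolutely_integrable_on_subinterval[OF assms(1)] assms(2,3) by auto

lemma integrable_subinterval_I01:
  fixes f :: "real \<Rightarrow> real"
  assumes "f absolutely_integrable_on I01" "0 \<le> x" "y \<le> 1"
  shows "f integrable_on {x..y}"
  using abs_int_subinterval[OF assms] absolutely_integrable_on_def by blast

lemma abs_integral_bound:
  fixes f g :: "real \<Rightarrow> real"
  assumes "f integrable_on S" "g integrable_on S" "\<And>x. x \<in> S \<Longrightarrow> \<bar>f x\<bar> \<le> g x"
  shows "\<bar>integral S f\<bar> \<le> integral S g"
  using Henstock_Kurzweil_Integration.integral_norm_bound_integral[OF assms(1,2)] assms(3) by auto

lemma abs_int_abs:
  fixes f :: "real \<Rightarrow> real"
  assumes "f absolutely_integrable_on I01"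
  shows "(\<lambda>t. \<bar>f t\<bar>) absolutely_integrable_on I01"
  using absolutely_integrable_norm[OF assms] by (simp add: comp_def)

lemma abs_int_continuous_mult:
  fixes f g :: "real \<Rightarrow> real"
  assumes "f absolutely_integrable_on I01" "continuous_on I01 g"
  shows "(\<lambda>t. g t * f t) absolutely_integrable_on I01"
proof (rule absolutely_integrable_bounded_measurable_product_real)
  show "g \<in> borel_measurable (lebesgue_on I01)"
    by (intro continuous_imp_measurable_on_sets_lebesgue assms) auto
  show "bounded (g ` I01)"
    by (intro compact_imp_bounded compact_continuous_image assms) auto
qed (use assms in auto)

lemma abs_int_continuous:
  fixes g :: "real \<Rightarrow> real"
  assumes "continuous_on I01 g"
  shows "g absolutely_integrable_on I01"
  using absolutely_integrable_continuous_real assms by blast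

lemma continuous_on_section:
  assumes "continuous_on (S \<times> T) (\<lambda>(x, t). g x t)" "x \<in> S"
  shows "continuous_on T (g x)"
proof -
  have "continuous_on T (\<lambda>t. (\<lambda>(x, t). g x t) (x, t))"
    by (rule continuous_on_compose2[OF assms(1)]) (use assms(2) in \<open>auto intro!: continuous_intros\<close>)
  then show ?thesis by simp
qed

lemma continuous_on_rectangle_bounded:
  fixes g :: "'a::topological_space \<Rightarrow> real \<Rightarrow> real"
  assumes "continuous_on (S \<times> I01) (\<lambda>(x, t). g x t)" "compact S"
  obtains C where "C > 0" "\<And>x t. x \<in> S \<Longrightarrow> t \<in> I01 \<Longrightarrow> \<bar>g x t\<bar> \<le> C"
proof -
  have "compact ((\<lambda>(x, t). g x t) ` (S \<times> I01))"
    by (intro compact_continuous_image assms compact_Times) auto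
  then have "bounded ((\<lambda>(x, t). g x t) ` (S \<times> I01))" by (rule compact_imp_bounded)
  then obtain C where "C > 0" "\<forall>y\<in>(\<lambda>(x, t). g x t) ` (S \<times> I01). norm y \<le> C"
    by (auto simp: bounded_pos)
  then show ?thesis by (intro that[of C]) force+
qed

lemma primitive_diff:
  assumes "primitive F f" "0 \<le> x" "x \<le> y" "y \<le> 1"
  shows "F y - F x = integral {x..y} f"
proof -
  have "integral {0..x} f + integral {x..y} f = integral {0..y} f"
    using assms primitive_density[OF assms(1)]
    by (intro Henstock_Kurzweil_Integration.integral_combine integrable_subinterval_I01) auto
  moreover have "F x = F 0 + integral {0..x} f" "F y = F 0 + integral {0..y} f"
    using assms by (intro primitive_eq[OF assms(1)]; simp)+
  ultimately show ?thesis by linarith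
qed

lemma primitiveI:
  assumes "f absolutely_integrable_on I01"
    and "\<And>x y. 0 \<le> x \<Longrightarrow> x \<le> y \<Longrightarrow> y \<le> 1 \<Longrightarrow> F y - F x = integral {x..y} f"
  shows "primitive F f"
  unfolding primitive_def
proof (intro conjI ballI assms(1))
  fix t :: real assume "t \<in> I01"
  then have "F t - F 0 = integral {0..t} f" by (intro assms(2)) auto
  then show "F t = F 0 + integral {0..t} f" by linarith
qed

lemma primitive_integral:
  assumes "f absolutely_integrable_on I01"
  shows "primitive (\<lambda>t. c + integral {0..t} f) f"
  unfolding primitive_def using assms by simp

lemma primitive_continuous:
  assumes "primitive F f"
  shows "continuous_on I01 F"
proof -
  have "continuous_on I01 (\<lambda>t. F 0 + integral {0..t} f)"
    using primitive_density[OF assms] by (intro continuous_intros indefinite_integral_continuous_1)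
      (auto simp: absolutely_integrable_on_def)
  then show ?thesis
    by (rule continuous_on_eq) (simp only: primitive_eq[OF assms, symmetric])
qed

lemma primitive_add:
  assumes "primitive F f" "primitive G g"
  shows "primitive (\<lambda>t. F t + G t) (\<lambda>t. f t + g t)"
proof (rule primitiveI)
  show "(\<lambda>t. f t + g t) absolutely_integrable_on I01"
    using assms[THEN primitive_density] by (rule set_integral_add)
  fix x y :: real assume xy: "0 \<le> x" "x \<le> y" "y \<le> 1"
  have "integral {x..y} (\<lambda>t. f t + g t) = integral {x..y} f + integral {x..y} g"
    using assms[THEN primitive_density] xy
    by (intro Henstock_Kurzweil_Integration.integral_add integrable_subinterval_I01) auto
  then show "F y + G y - (F x + G x) = integral {x..y} (\<lambda>t. f t + g t)"
    using primitive_diff[OF assms(1) xy] primitive_diff[OF assms(2) xy] by simp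
qed

lemma primitive_cmult:
  assumes "primitive F f"
  shows "primitive (\<lambda>t. c * F t) (\<lambda>t. c * f t)"
proof (rule primitiveI)
  show "(\<lambda>t. c * f t) absolutely_integrable_on I01"
    using primitive_density[OF assms] by (intro abs_int_continuous_mult continuous_intros)
  fix x y :: real assume xy: "0 \<le> x" "x \<le> y" "y \<le> 1"
  show "c * F y - c * F x = integral {x..y} (\<lambda>t. c * f t)"
    using primitive_diff[OF assms(1) xy] by (simp add: right_diff_distrib[symmetric])
qed

lemma primitive_cong:
  assumes "primitive F f" "\<And>t. t \<in> I01 \<Longrightarrow> F t = G t" "\<And>t. t \<in> I01 \<Longrightarrow> f t = g t"
  shows "primitive G g"
proof (rule primitiveI)
  have "f absolutely_integrable_on I01 \<longleftrightarrow> g absolutely_integrable_on I01"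
    by (intro set_integrable_cong) (use assms in auto)
  then show "g absolutely_integrable_on I01" using primitive_density[OF assms(1)] by simp
  fix x y :: real assume xy: "0 \<le> x" "x \<le> y" "y \<le> 1"
  have "integral {x..y} f = integral {x..y} g"
    by (rule integral_cong) (use assms xy in auto)
  then show "G y - G x = integral {x..y} g"
    using primitive_diff[OF assms(1) xy] assms(2) xy by auto
qed

text \<open>Naming the derivative as an argument avoids reasoning about \<^const>\<open>deriv_I\<close> outside the lemmas
  that connect the two.\<close>

definition C1_on_I :: "(real \<Rightarrow> real) \<Rightarrow> (real \<Rightarrow> real) \<Rightarrow> bool" where
  "C1_on_I u u1 \<longleftrightarrow>
     (\<forall>t\<in>I01. (u has_real_derivative u1 t) (at t within I01)) \<and> continuous_on I01 u1"

lemma C1_continuous: "C1_on_I u u1 \<Longrightarrow> continuous_on I01 u"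
  unfolding C1_on_I_def by (meson DERIV_continuous continuous_on_eq_continuous_within)

lemma C1_imp_primitive:
  assumes "C1_on_I u u1" shows "primitive u u1"
proof (rule primitiveI)
  show "u1 absolutely_integrable_on I01"
    using assms abs_int_continuous by (auto simp: C1_on_I_def)
  fix x y :: real assume xy: "0 \<le> x" "x \<le> y" "y \<le> 1"
  have "(u1 has_integral (u y - u x)) {x..y}"
  proof (rule fundamental_theorem_of_calculus[OF xy(2)])
    fix t assume "t \<in> {x..y}"
    then have "(u has_real_derivative u1 t) (at t within I01)"
      using assms xy by (auto simp: C1_on_I_def)
    then have "(u has_real_derivative u1 t) (at t within {x..y})"
      by (rule DERIV_subset) (use xy in auto)
    then show "(u has_vector_derivative u1 t) (at t within {x..y})"
      by (simp add: has_real_derivative_iff_has_vector_derivative)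
  qed
  then show "u y - u x = integral {x..y} u1" by (simp add: integral_unique)
qed

lemma continuous_density_imp_C1:
  assumes "primitive u u1" "continuous_on I01 u1"
  shows "C1_on_I u u1"
  unfolding C1_on_I_def
proof (intro conjI ballI assms(2))
  fix t :: real assume t: "t \<in> I01"
  have "((\<lambda>t. integral {0..t} u1) has_real_derivative u1 t) (at t within I01)"
    using integral_has_real_derivative[OF assms(2) t] by simp
  then have "((\<lambda>t. u 0 + integral {0..t} u1) has_real_derivative u1 t) (at t within I01)"
    by (auto intro!: derivative_eq_intros)
  then show "(u has_real_derivative u1 t) (at t within I01)"
    by (rule has_field_derivative_transform_within[where d = 1])
      (use t in \<open>simp_all only: primitive_eq[OF assms(1), symmetric] zero_less_one\<close>)
qed

text \<open>Since \<open>\<integral>\<^sub>x\<^sup>y p\<close> tends to \<open>0\<close> with \<open>y - x\<close>, the increments of \<open>G\<close> are of smaller order than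
  the step at every point, so \<open>G' = 0\<close> everywhere on the interval. This replaces arguments that
  differentiate an indefinite integral almost everywhere.\<close>

lemma superlinear_increment_imp_constant:
  fixes G p :: "real \<Rightarrow> real"
  assumes p: "p absolutely_integrable_on I01"
    and G: "\<And>x y. 0 \<le> x \<Longrightarrow> x \<le> y \<Longrightarrow> y \<le> 1 \<Longrightarrow> \<bar>G y - G x\<bar> \<le> (y - x) * integral {x..y} p"
    and t: "t \<in> I01"
  shows "G t = G 0"
proof -
  let ?P = "\<lambda>t. integral {0..t} p"
  have P: "primitive ?P p" using primitive_integral[OF p, of 0] by simp
  have inc: "\<bar>G y - G x\<bar> \<le> \<bar>y - x\<bar> * \<bar>?P y - ?P x\<bar>" if "x \<in> I01" "y \<in> I01" for x y
  proof (cases "x \<le> y")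
    case True
    then have "\<bar>G y - G x\<bar> \<le> (y - x) * (?P y - ?P x)"
      using G[of x y] primitive_diff[OF P, of x y] that by auto
    also have "\<dots> \<le> \<bar>y - x\<bar> * \<bar>?P y - ?P x\<bar>" by (metis abs_ge_self abs_mult)
    finally show ?thesis .
  next
    case False
    then have "\<bar>G x - G y\<bar> \<le> (x - y) * (?P x - ?P y)"
      using G[of y x] primitive_diff[OF P, of y x] that by auto
    also have "\<dots> \<le> \<bar>x - y\<bar> * \<bar>?P x - ?P y\<bar>" by (metis abs_ge_self abs_mult)
    finally show ?thesis by (simp add: abs_minus_commute)
  qed
  have "(G has_real_derivative 0) (at x within I01)" if x: "x \<in> I01" for x
  proof -
    have "continuous_on I01 ?P" by (rule primitive_continuous[OF P])
    then have "((\<lambda>y. \<bar>?P y - ?P x\<bar>) \<longlongrightarrow> \<bar>?P x - ?P x\<bar>) (at x within I01)"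
      using x by (intro tendsto_intros) (simp add: continuous_on_def)
    then have lim: "((\<lambda>y. \<bar>?P y - ?P x\<bar>) \<longlongrightarrow> 0) (at x within I01)" by simp
    have ev: "\<forall>\<^sub>F y in at x within I01. norm ((G y - G x) / (y - x)) \<le> \<bar>?P y - ?P x\<bar>"
    proof (unfold eventually_at_filter, rule always_eventually, intro allI impI)
      fix y assume "y \<noteq> x" "y \<in> I01"
      then show "norm ((G y - G x) / (y - x)) \<le> \<bar>?P y - ?P x\<bar>"
        using inc[OF x, of y] by (simp add: abs_divide divide_le_eq mult.commute)
    qed
    have "((\<lambda>y. (G y - G x) / (y - x)) \<longlongrightarrow> 0) (at x within I01)"
      by (rule Lim_null_comparison[OF ev lim])
    then show ?thesis by (simp add: has_field_derivative_iff)
  qed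
  then have "\<exists>c. \<forall>x\<in>I01. G x = c"
    by (intro has_field_derivative_zero_constant) auto
  then show ?thesis using t by auto
qed

text \<open>Product rule for a \<open>C\<^sup>1\<close> and an absolutely continuous factor. The difference \<open>G\<close> between
  \<open>u F\<close> and the integral of the expected density has the increment
  \<open>\<integral>\<^sub>x\<^sup>y (F x - F t) u' t + (u y - u t) f t dt\<close>. Both terms are at most
  \<open>sup \<bar>u'\<bar> (y - x) \<integral>\<^sub>x\<^sup>y \<bar>f\<bar>\<close>, so \<open>G\<close> is constant by the preceding lemma.\<close>

lemma primitive_mult:
  assumes u: "C1_on_I u u1" and F: "primitive F f"
  shows "primitive (\<lambda>t. u t * F t) (\<lambda>t. u1 t * F t + u t * f t)"
proof -
  have cu: "continuous_on I01 u" by (rule C1_continuous[OF u])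
  have cu1: "continuous_on I01 u1" using u by (simp add: C1_on_I_def)
  have cF: "continuous_on I01 F" by (rule primitive_continuous[OF F])
  have fi: "f absolutely_integrable_on I01" by (rule primitive_density[OF F])
  have pu: "primitive u u1" by (rule C1_imp_primitive[OF u])
  obtain B where B: "\<And>t. t \<in> I01 \<Longrightarrow> \<bar>u1 t\<bar> \<le> B"
  proof -
    have "bounded (u1 ` I01)" by (intro compact_imp_bounded compact_continuous_image cu1) auto
    then show ?thesis using that by (force simp: bounded_iff)
  qed
  have i1: "(\<lambda>t. u1 t * F t) absolutely_integrable_on I01"
    by (intro abs_int_continuous continuous_intros cu1 cF)
  have i2: "(\<lambda>t. u t * f t) absolutely_integrable_on I01"
    by (rule abs_int_continuous_mult[OF fi cu])
  let ?g = "\<lambda>t. u1 t * F t + u t * f t"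
  have gi: "?g absolutely_integrable_on I01" by (rule set_integral_add(1)[OF i1 i2])
  have pg: "primitive (\<lambda>t. integral {0..t} ?g) ?g" using primitive_integral[OF gi, of 0] by simp
  have fabs: "(\<lambda>t. \<bar>f t\<bar>) absolutely_integrable_on I01"
    by (rule abs_int_abs[OF fi])
  let ?G = "\<lambda>t. u t * F t - integral {0..t} ?g"
  have const: "?G t = ?G 0" if "t \<in> I01" for t
  proof (rule superlinear_increment_imp_constant[OF _ _ that])
    show "(\<lambda>t. 2 * B * \<bar>f t\<bar>) absolutely_integrable_on I01"
      by (intro abs_int_continuous_mult fabs continuous_intros)
    fix x y :: real assume xy: "0 \<le> x" "x \<le> y" "y \<le> 1"
    have absxy: "(\<lambda>t. \<bar>f t\<bar>) integrable_on {x..y}"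
      by (rule integrable_subinterval_I01[OF fabs]) (use xy in auto)
    have e1: "\<bar>(F x - F t) * u1 t\<bar> \<le> B * integral {x..y} (\<lambda>t. \<bar>f t\<bar>)" if t: "t \<in> {x..y}" for t
    proof -
      have "F t - F x = integral {x..t} f" using primitive_diff[OF F, of x t] xy t by auto
      moreover have "\<bar>integral {x..t} f\<bar> \<le> integral {x..t} (\<lambda>t. \<bar>f t\<bar>)"
        using xy t by (intro abs_integral_bound integrable_subinterval_I01 fi fabs) auto
      moreover have "integral {x..t} (\<lambda>t. \<bar>f t\<bar>) \<le> integral {x..y} (\<lambda>t. \<bar>f t\<bar>)"
        using xy t by (intro integral_subset_le integrable_subinterval_I01 fabs) auto
      ultimately have "\<bar>F x - F t\<bar> \<le> integral {x..y} (\<lambda>t. \<bar>f t\<bar>)" by linarith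
      moreover have "\<bar>u1 t\<bar> \<le> B" using B xy t by auto
      ultimately show ?thesis unfolding abs_mult by (subst mult.commute) (intro mult_mono; auto)
    qed
    have e2: "\<bar>(u y - u t) * f t\<bar> \<le> B * (y - x) * \<bar>f t\<bar>" if t: "t \<in> {x..y}" for t
    proof -
      have "\<bar>u y - u t\<bar> \<le> B * \<bar>y - t\<bar>"
      proof -
        have "norm (u y - u t) \<le> B * norm (y - t)"
          by (rule field_differentiable_bound[of I01 u u1 B])
            (use u B xy t in \<open>auto simp: C1_on_I_def\<close>)
        then show ?thesis by simp
      qed
      also have "\<dots> \<le> B * (y - x)"
        by (rule mult_left_mono) (use t B[of t] xy in auto)
      finally show ?thesis by (simp add: abs_mult mult_right_mono)
    qed
    have ib1: "(\<lambda>t. (F x - F t) * u1 t) integrable_on {x..y}"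
      using xy by (intro integrable_continuous_real continuous_intros)
        (auto intro: continuous_on_subset[OF cF] continuous_on_subset[OF cu1])
    have ib2: "(\<lambda>t. (u y - u t) * f t) integrable_on {x..y}"
      by (rule integrable_subinterval_I01[OF abs_int_continuous_mult[OF fi]])
        (use xy cu in \<open>auto intro!: continuous_intros\<close>)
    have "?G y - ?G x = u y * F y - u x * F x - integral {x..y} ?g"
      using primitive_diff[OF pg xy] by simp
    also have "u y * F y - u x * F x = u y * (F y - F x) + F x * (u y - u x)"
      by (simp add: algebra_simps)
    also have "\<dots> = u y * integral {x..y} f + F x * integral {x..y} u1"
      using primitive_diff[OF F xy] primitive_diff[OF pu xy] by simp
    also have "\<dots> = integral {x..y} (\<lambda>t. u y * f t) + integral {x..y} (\<lambda>t. F x * u1 t)" by simp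
    also have "\<dots> = integral {x..y} (\<lambda>t. u y * f t + F x * u1 t)"
    proof (rule Henstock_Kurzweil_Integration.integral_add[symmetric])
      show "(\<lambda>t. u y * f t) integrable_on {x..y}"
        using xy by (intro integrable_on_mult_right integrable_subinterval_I01 fi) auto
      show "(\<lambda>t. F x * u1 t) integrable_on {x..y}"
        using xy by (intro integrable_on_mult_right integrable_subinterval_I01
          abs_int_continuous cu1) auto
    qed
    also have "\<dots> - integral {x..y} ?g = integral {x..y} (\<lambda>t. (u y * f t + F x * u1 t) - ?g t)"
    proof (rule Henstock_Kurzweil_Integration.integral_diff[symmetric])
      have "(\<lambda>t. u y * f t) absolutely_integrable_on I01" "(\<lambda>t. F x * u1 t) absolutely_integrable_on I01"
        by (rule abs_int_continuous_mult[OF fi], simp)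
          (intro abs_int_continuous cu1 continuous_intros)
      then show "(\<lambda>t. u y * f t + F x * u1 t) integrable_on {x..y}"
        using xy by (intro integrable_subinterval_I01 set_integral_add) auto
      show "?g integrable_on {x..y}" using xy by (intro integrable_subinterval_I01 gi) auto
    qed
    also have "\<dots> = integral {x..y} (\<lambda>t. (F x - F t) * u1 t + (u y - u t) * f t)"
      by (rule integral_cong) (simp add: algebra_simps)
    also have "\<dots> = integral {x..y} (\<lambda>t. (F x - F t) * u1 t) + integral {x..y} (\<lambda>t. (u y - u t) * f t)"
      by (rule Henstock_Kurzweil_Integration.integral_add[OF ib1 ib2])
    finally have eq: "?G y - ?G x = \<dots>" .
    have "\<bar>integral {x..y} (\<lambda>t. (F x - F t) * u1 t)\<bar>
        \<le> integral {x..y} (\<lambda>_. B * integral {x..y} (\<lambda>t. \<bar>f t\<bar>))"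
      by (rule abs_integral_bound[OF ib1 _ e1]) auto
    also have "\<dots> = (y - x) * (B * integral {x..y} (\<lambda>t. \<bar>f t\<bar>))" using xy by simp
    finally have b1: "\<bar>integral {x..y} (\<lambda>t. (F x - F t) * u1 t)\<bar> \<le> \<dots>" .
    have "\<bar>integral {x..y} (\<lambda>t. (u y - u t) * f t)\<bar>
        \<le> integral {x..y} (\<lambda>t. B * (y - x) * \<bar>f t\<bar>)"
      by (rule abs_integral_bound[OF ib2 _ e2])
        (auto intro: integrable_on_mult_right absxy)
    also have "\<dots> = B * (y - x) * integral {x..y} (\<lambda>t. \<bar>f t\<bar>)" by simp
    finally have b2: "\<bar>integral {x..y} (\<lambda>t. (u y - u t) * f t)\<bar> \<le> \<dots>" .
    show "\<bar>?G y - ?G x\<bar> \<le> (y - x) * integral {x..y} (\<lambda>t. 2 * B * \<bar>f t\<bar>)"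
      unfolding eq using b1 b2 by (simp add: algebra_simps)
  qed
  show ?thesis
    unfolding primitive_def
  proof (intro conjI ballI gi)
    fix t :: real assume "t \<in> I01"
    then have "u t * F t - integral {0..t} ?g = u 0 * F 0" using const[of t] by simp
    then show "u t * F t = u 0 * F 0 + integral {0..t} ?g" by linarith
  qed
qed

section \<open>Absolute continuity and differentiation almost everywhere\<close>

lemma tail_integral_tendsto_0:
  fixes f :: "real \<Rightarrow> real"
  assumes f: "f absolutely_integrable_on I01"
  shows "(\<lambda>n. integral I01 (\<lambda>t. max (\<bar>f t\<bar> - real n) 0)) \<longlonglongrightarrow> 0"
proof -
  have fabs: "(\<lambda>t. \<bar>f t\<bar>) absolutely_integrable_on I01"
    by (rule abs_int_abs[OF f])
  have tail: "(\<lambda>t. max (\<bar>f t\<bar> - real n) 0) absolutely_integrable_on I01" for n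
    by (intro absolutely_integrable_max_1 set_integral_diff fabs abs_int_continuous continuous_intros)
  have "(\<lambda>n. integral I01 (\<lambda>t. max (\<bar>f t\<bar> - real n) 0)) \<longlonglongrightarrow> integral I01 (\<lambda>_. 0::real)"
  proof (rule dominated_convergence(2)[where h = "\<lambda>t. \<bar>f t\<bar>"])
    show "(\<lambda>t. max (\<bar>f t\<bar> - real n) 0) integrable_on I01" for n
      using tail absolutely_integrable_on_def by blast
    show "(\<lambda>t. \<bar>f t\<bar>) integrable_on I01"
      using fabs absolutely_integrable_on_def by blast
    fix t :: real assume "t \<in> I01"
    obtain N where N: "\<bar>f t\<bar> \<le> real N" using real_arch_simple by blast
    have "\<forall>\<^sub>F n in sequentially. max (\<bar>f t\<bar> - real n) 0 = 0"
      using eventually_ge_at_top[of N] by eventually_elim (use N in auto)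
    then show "(\<lambda>n. max (\<bar>f t\<bar> - real n) 0) \<longlonglongrightarrow> 0" by (rule tendsto_eventually)
  qed auto
  then show ?thesis by simp
qed

text \<open>Disjointness is assumed for the open intervals only, so the integrals are first rewritten as
  integrals of \<open>g\<close> times the indicators of the open intervals.\<close>

lemma sum_integral_disjoint_le:
  fixes g :: "real \<Rightarrow> real" and P :: "(real \<times> real) set"
  assumes g: "g absolutely_integrable_on I01" "\<And>t. 0 \<le> g t"
    and P: "finite P" "\<And>x y. (x, y) \<in> P \<Longrightarrow> x \<le> y \<and> {x..y} \<subseteq> I01"
      "disjoint_family_on (\<lambda>(x, y). {x<..<y}) P"
  shows "(\<Sum>(x, y)\<in>P. integral {x..y} g) \<le> integral I01 g"
proof -
  let ?A = "\<lambda>i::real \<times> real. {fst i<..<snd i}"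
  have dis: "disjoint_family_on ?A P" using P(3) by (simp add: case_prod_beta')
  have hi: "((\<lambda>t. indicator (?A i) t * g t) has_integral integral {fst i..snd i} g) I01"
    if "i \<in> P" for i
  proof -
    have xy: "fst i \<le> snd i" "{fst i..snd i} \<subseteq> I01" using P(2)[of "fst i" "snd i"] that by auto
    then have le: "0 \<le> fst i" "snd i \<le> 1" by auto
    have gi: "g integrable_on {fst i..snd i}" by (rule integrable_subinterval_I01[OF g(1) le])
    then have "(g has_integral integral {fst i..snd i} g) (?A i)"
      by (simp add: integrable_integral has_integral_Icc_iff_Ioo[symmetric])
    then have "((\<lambda>t. if t \<in> ?A i then g t else 0) has_integral integral {fst i..snd i} g) I01"
      by (subst has_integral_restrict) (use xy in auto)
    then show ?thesis by (rule has_integral_eq[rotated]) (auto simp: indicator_def)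
  qed
  have "((\<lambda>t. \<Sum>i\<in>P. indicator (?A i) t * g t) has_integral (\<Sum>i\<in>P. integral {fst i..snd i} g)) I01"
    by (rule has_integral_sum[OF P(1) hi])
  moreover have "(g has_integral integral I01 g) I01"
    using g(1) by (auto simp: absolutely_integrable_on_def)
  moreover have "(\<Sum>i\<in>P. indicator (?A i) t * g t) \<le> g t" for t
  proof -
    have "(\<Sum>i\<in>P. indicator (?A i) t * g t) = (\<Sum>i\<in>P. indicator (?A i) t) * g t"
      by (simp add: sum_distrib_right)
    also have "(\<Sum>i\<in>P. indicator (?A i) t) = (indicator (\<Union>i\<in>P. ?A i) t :: real)"
      by (rule indicator_UN_disjoint[OF P(1) dis, symmetric])
    also have "\<dots> * g t \<le> 1 * g t" using g(2)[of t] by (intro mult_right_mono indicator_le_1)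
    finally show ?thesis by simp
  qed
  ultimately have "(\<Sum>i\<in>P. integral {fst i..snd i} g) \<le> integral I01 g"
    by (rule has_integral_le)
  then show ?thesis by (simp add: case_prod_beta')
qed

text \<open>Split \<open>\<bar>f\<bar> \<le> N + max (\<bar>f\<bar> - N) 0\<close>. The second part has small integral for large \<open>N\<close>,
  whatever the intervals, and the first contributes at most \<open>N\<close> times their total length.\<close>

lemma primitive_abs_continuous:
  assumes F: "primitive F f"
  shows "abs_continuous_on I01 F"
  unfolding abs_continuous_on_def
proof (intro allI impI)
  fix e :: real assume "e > 0"
  have f: "f absolutely_integrable_on I01" by (rule primitive_density[OF F])
  have fabs: "(\<lambda>t. \<bar>f t\<bar>) absolutely_integrable_on I01"
    by (rule abs_int_abs[OF f])
  have "\<forall>\<^sub>F n in sequentially. integral I01 (\<lambda>t. max (\<bar>f t\<bar> - real n) 0) < e / 2"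
    using tail_integral_tendsto_0[OF f] \<open>e > 0\<close> by (intro order_tendstoD) auto
  then obtain N where N: "integral I01 (\<lambda>t. max (\<bar>f t\<bar> - real N) 0) < e / 2"
    by (auto simp: eventually_sequentially)
  let ?g = "\<lambda>t. max (\<bar>f t\<bar> - real N) 0"
  have g: "?g absolutely_integrable_on I01"
    by (intro absolutely_integrable_max_1 set_integral_diff fabs abs_int_continuous continuous_intros)
  \<comment> \<open>The \<open>+ 1\<close> only guards against \<open>N = 0\<close>.\<close>
  define d where "d = e / (2 * (real N + 1))"
  have "d > 0" using \<open>e > 0\<close> by (simp add: d_def)
  show "\<exists>d>0. \<forall>P. finite P \<longrightarrow> (\<forall>(x, y)\<in>P. x \<le> y \<and> {x..y} \<subseteq> I01) \<longrightarrow>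
      disjoint_family_on (\<lambda>(x, y). {x<..<y}) P \<longrightarrow> (\<Sum>(x, y)\<in>P. y - x) < d \<longrightarrow>
      (\<Sum>(x, y)\<in>P. \<bar>F y - F x\<bar>) < e"
  proof (intro exI[of _ d] conjI allI impI \<open>d > 0\<close>)
    fix P :: "(real \<times> real) set"
    assume fin: "finite P" and P: "\<forall>(x, y)\<in>P. x \<le> y \<and> {x..y} \<subseteq> I01"
      and dis: "disjoint_family_on (\<lambda>(x, y). {x<..<y}) P" and len: "(\<Sum>(x, y)\<in>P. y - x) < d"
    have one: "\<bar>F y - F x\<bar> \<le> real N * (y - x) + integral {x..y} ?g" if "(x, y) \<in> P" for x y
    proof -
      have xy: "x \<le> y" "{x..y} \<subseteq> I01" using P that by auto
      then have b: "0 \<le> x" "y \<le> 1" by auto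
      have "\<bar>F y - F x\<bar> = \<bar>integral {x..y} f\<bar>" using primitive_diff[OF F b(1) xy(1) b(2)] by simp
      also have "\<dots> \<le> integral {x..y} (\<lambda>t. real N + ?g t)"
        by (intro abs_integral_bound integrable_add integrable_subinterval_I01[OF _ b] f g)
          auto
      also have "\<dots> = real N * (y - x) + integral {x..y} ?g"
        using xy by (subst Henstock_Kurzweil_Integration.integral_add)
          (auto intro!: integrable_subinterval_I01[OF _ b] g)
      finally show ?thesis .
    qed
    have "(\<Sum>(x, y)\<in>P. \<bar>F y - F x\<bar>) \<le> (\<Sum>(x, y)\<in>P. real N * (y - x) + integral {x..y} ?g)"
      by (rule sum_mono) (use one in auto)
    also have "\<dots> = real N * (\<Sum>(x, y)\<in>P. y - x) + (\<Sum>(x, y)\<in>P. integral {x..y} ?g)"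
      by (simp add: case_prod_beta' sum.distrib sum_distrib_left)
    also have "\<dots> \<le> real N * d + integral I01 ?g"
      using len by (intro add_mono mult_left_mono sum_integral_disjoint_le g fin dis) (use P in auto)
    also have "real N * d \<le> e / 2" using \<open>e > 0\<close> by (simp add: d_def field_simps)
    finally show "(\<Sum>(x, y)\<in>P. \<bar>F y - F x\<bar>) < e" using N by simp
  qed
qed

text \<open>The heart of Lebesgue's differentiation theorem. By Henstock's lemma there is a gauge such
  that the errors \<open>\<bar>F y - F x - (y - x) f x\<bar>\<close> over finitely many nonoverlapping fine intervals
  with tag \<open>x\<close> at one end sum to less than \<open>e \<epsilon>\<close>. The intervals on which the error is at least
  \<open>e \<bar>y - x\<bar>\<close> cover the exceptional set in the sense of Vitali. A disjoint subfamily covers almost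
  all of it, and its total length is at most \<open>\<epsilon>\<close> by the bound on the errors.\<close>

lemma non_derivative_set_negligible:
  assumes F: "primitive F f" and "0 < e"
  shows "negligible {x \<in> I01. \<forall>d>0. \<exists>y\<in>I01. y \<noteq> x \<and> \<bar>y - x\<bar> < d \<and>
           e * \<bar>y - x\<bar> \<le> \<bar>F y - F x - (y - x) * f x\<bar>}" (is "negligible ?E")
  unfolding negligible_outer_le
proof (intro allI impI)
  fix \<epsilon> :: real assume "\<epsilon> > 0"
  have "f absolutely_integrable_on I01" by (rule primitive_density[OF F])
  then have "f integrable_on cbox 0 1" by (simp add: absolutely_integrable_on_def)
  moreover have "e * \<epsilon> > 0" using \<open>e > 0\<close> \<open>\<epsilon> > 0\<close> by simp
  ultimately obtain \<gamma> where "gauge \<gamma>" and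
    \<gamma>: "\<And>p. p tagged_partial_division_of cbox 0 1 \<Longrightarrow> \<gamma> fine p \<Longrightarrow>
          (\<Sum>(x, K)\<in>p. norm (measure lborel K *\<^sub>R f x - integral K f)) < e * \<epsilon>"
    by (rule Henstock_lemma) blast
  \<comment> \<open>A pair \<open>(x, y)\<close> stands for the interval with end points \<open>x\<close> and \<open>y\<close>, in either order, tagged at \<open>x\<close>.\<close>
  define c where "c i = (fst i + snd i) / 2" for i :: "real \<times> real"
  define r where "r i = \<bar>snd i - fst i\<bar> / 2" for i :: "real \<times> real"
  have ball: "cball (c i) (r i) = {min (fst i) (snd i)..max (fst i) (snd i)}" for i
    by (auto simp: cball_eq_atLeastAtMost c_def r_def min_def max_def field_simps abs_if split: if_splits)
  define V where "V = {(x, y). x \<in> I01 \<and> y \<in> I01 \<and> y \<noteq> x \<and> cball (c (x, y)) (r (x, y)) \<subseteq> \<gamma> x \<and>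
      e * \<bar>y - x\<bar> \<le> \<bar>F y - F x - (y - x) * f x\<bar>}"
  obtain C where C: "countable C" "C \<subseteq> V"
      "pairwise (\<lambda>i j. disjnt (cball (c i) (r i)) (cball (c j) (r j))) C"
      "negligible (?E - (\<Union>i\<in>C. cball (c i) (r i)))"
  proof (rule Vitali_covering_theorem_cballs[of V r ?E c])
    show "0 < r i" if "i \<in> V" for i using that by (auto simp: V_def r_def)
    fix x d :: real assume x: "x \<in> ?E" and "0 < d"
    obtain \<eta> where \<eta>: "\<eta> > 0" "ball x \<eta> \<subseteq> \<gamma> x"
      using \<open>gauge \<gamma>\<close> by (metis gauge_def openE)
    have "min d \<eta> > 0" using \<open>0 < d\<close> \<eta> by simp
    then obtain y where y: "y \<in> I01" "y \<noteq> x" "\<bar>y - x\<bar> < min d \<eta>"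
        "e * \<bar>y - x\<bar> \<le> \<bar>F y - F x - (y - x) * f x\<bar>"
      using x by blast
    have "cball (c (x, y)) (r (x, y)) \<subseteq> ball x \<eta>"
      using y(3) by (auto simp: ball dist_real_def)
    then have "(x, y) \<in> V" using x y \<eta> by (auto simp: V_def)
    moreover have "x \<in> cball (c (x, y)) (r (x, y))" by (simp add: ball)
    moreover have "r (x, y) < d" using y \<open>0 < d\<close> by (simp add: r_def)
    ultimately show "\<exists>i. i \<in> V \<and> x \<in> cball (c i) (r i) \<and> r i < d" by blast
  qed
  have bound: "measure lebesgue (\<Union>i\<in>D. cball (c i) (r i)) \<le> \<epsilon>" if D: "D \<subseteq> C" "finite D" for D
  proof -
    let ?p = "(\<lambda>i. (fst i, cball (c i) (r i))) ` D"
    have djD: "disjnt (cball (c i) (r i)) (cball (c j) (r j))" if "i \<in> D" "j \<in> D" "i \<noteq> j" for i j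
      using C(3) D(1) that by (auto simp: pairwise_def)
    have "inj_on (\<lambda>i. (fst i, cball (c i) (r i))) D"
    proof (rule inj_onI, rule ccontr)
      fix i j assume "i \<in> D" "j \<in> D" "i \<noteq> j"
        and eq: "(fst i, cball (c i) (r i)) = (fst j, cball (c j) (r j))"
      then have "disjnt (cball (c i) (r i)) (cball (c i) (r i))" using djD[of i j] by simp
      then show False by (simp add: ball)
    qed
    note inj = this
    have part: "?p tagged_partial_division_of cbox 0 1"
      unfolding tagged_partial_division_of_def
    proof (intro conjI allI impI)
      show "finite ?p" using D by simp
    next
      fix x K assume "(x, K) \<in> ?p"
      then obtain i where i: "i \<in> D" "x = fst i" "K = cball (c i) (r i)" by auto
      then have "i \<in> V" using C D by auto
      then have iI: "fst i \<in> I01" "snd i \<in> I01" by (auto simp: V_def)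
      show "x \<in> K" by (simp add: i ball)
      show "K \<subseteq> cbox 0 1" using iI by (auto simp: i ball)
      show "\<exists>a b. K = cbox a b" by (auto simp: i ball)
    next
      fix x1 K1 x2 K2 assume "(x1, K1) \<in> ?p \<and> (x2, K2) \<in> ?p \<and> (x1, K1) \<noteq> (x2, K2)"
      then obtain i j where "i \<in> D" "j \<in> D" "i \<noteq> j" "K1 = cball (c i) (r i)" "K2 = cball (c j) (r j)"
        by auto
      then have "disjnt K1 K2" using djD by auto
      then show "interior K1 \<inter> interior K2 = {}"
        using interior_subset by (fastforce simp: disjnt_def)
    qed
    moreover have "\<gamma> fine ?p"
      using C(2) D(1) by (fastforce simp: fine_def V_def)
    ultimately have "(\<Sum>(x, K)\<in>?p. norm (measure lborel K *\<^sub>R f x - integral K f)) < e * \<epsilon>" by (rule \<gamma>)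
    then have less: "(\<Sum>i\<in>D. \<bar>measure lborel (cball (c i) (r i)) * f (fst i) - integral (cball (c i) (r i)) f\<bar>)
        < e * \<epsilon>"
      by (simp add: sum.reindex[OF inj] comp_def)
    have len: "measure lborel (cball (c i) (r i)) = \<bar>snd i - fst i\<bar>" for i
      by (auto simp: ball min_def max_def)
    have "e * measure lborel (cball (c i) (r i))
        \<le> \<bar>measure lborel (cball (c i) (r i)) * f (fst i) - integral (cball (c i) (r i)) f\<bar>" if "i \<in> D" for i
    proof -
      obtain x y where i: "i = (x, y)" by fastforce
      have "i \<in> V" using that C D by auto
      then have xy: "0 \<le> x" "x \<le> 1" "0 \<le> y" "y \<le> 1"
        and ineq: "e * \<bar>y - x\<bar> \<le> \<bar>F y - F x - (y - x) * f x\<bar>"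
        by (auto simp: V_def i)
      show ?thesis
      proof (cases "x \<le> y")
        case True
        then have "integral (cball (c i) (r i)) f = F y - F x"
          using primitive_diff[OF F, of x y] xy by (simp add: ball i)
        then show ?thesis using ineq True unfolding len by (simp add: i abs_minus_commute)
      next
        case False
        then have "integral (cball (c i) (r i)) f = F x - F y"
          using primitive_diff[OF F, of y x] xy by (simp add: ball i)
        then show ?thesis using ineq False unfolding len by (simp add: i algebra_simps)
      qed
    qed
    then have "(\<Sum>i\<in>D. e * measure lborel (cball (c i) (r i)))
        \<le> (\<Sum>i\<in>D. \<bar>measure lborel (cball (c i) (r i)) * f (fst i) - integral (cball (c i) (r i)) f\<bar>)"
      by (rule sum_mono)
    with less have "e * (\<Sum>i\<in>D. measure lborel (cball (c i) (r i))) < e * \<epsilon>"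
      by (simp add: sum_distrib_left)
    then have "(\<Sum>i\<in>D. measure lborel (cball (c i) (r i))) < \<epsilon>" using \<open>e > 0\<close> by simp
    moreover have "measure lebesgue (\<Union>i\<in>D. cball (c i) (r i)) \<le> (\<Sum>i\<in>D. measure lborel (cball (c i) (r i)))"
      using measure_UNION_le[of D "\<lambda>i. cball (c i) (r i)" lebesgue] D by simp
    ultimately show ?thesis by simp
  qed
  let ?U = "\<Union>i\<in>C. cball (c i) (r i)"
  have U: "?U \<in> lmeasurable" "measure lebesgue ?U \<le> \<epsilon>"
    by (rule fmeasurable_UN_bound[OF C(1) _ bound] measure_UN_bound[OF C(1) _ bound]; simp)+
  have N: "?E - ?U \<in> lmeasurable" using C(4) by (rule negligible_imp_measurable)
  show "\<exists>T. ?E \<subseteq> T \<and> T \<in> lmeasurable \<and> measure lebesgue T \<le> \<epsilon>"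
  proof (intro exI conjI)
    show "?E \<subseteq> ?U \<union> (?E - ?U)" by blast
    show "?U \<union> (?E - ?U) \<in> lmeasurable" using U(1) N by (rule fmeasurable.Un)
    have "measure lebesgue (?U \<union> (?E - ?U)) \<le> measure lebesgue ?U + measure lebesgue (?E - ?U)"
      by (rule measure_Un_le) (use U(1) N in auto)
    also have "measure lebesgue (?E - ?U) = 0" using C(4) by (rule negligible_imp_measure0)
    finally show "measure lebesgue (?U \<union> (?E - ?U)) \<le> \<epsilon>" using U(2) by simp
  qed
qed

lemma primitive_AE_derivative:
  assumes F: "primitive F f"
  shows "AE t in lebesgue_on I01. (F has_real_derivative f t) (at t within I01)"
proof -
  let ?E = "\<lambda>n::nat. {x \<in> I01. \<forall>d>0. \<exists>y\<in>I01. y \<noteq> x \<and> \<bar>y - x\<bar> < d \<and>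
           1 / Suc n * \<bar>y - x\<bar> \<le> \<bar>F y - F x - (y - x) * f x\<bar>}"
  have "negligible (\<Union>n. ?E n)"
  proof (rule negligible_countable_Union)
    show "countable (range ?E)" by simp
    fix T assume "T \<in> range ?E"
    then obtain n where "T = ?E n" by blast
    then show "negligible T" using non_derivative_set_negligible[OF F, of "1 / Suc n"] by simp
  qed
  then have null: "(\<Union>n. ?E n) \<in> null_sets lebesgue" by (simp only: negligible_iff_null_sets)
  have der: "(F has_real_derivative f x) (at x within I01)" if x: "x \<in> I01" "x \<notin> (\<Union>n. ?E n)" for x
    unfolding has_field_derivative_iff tendsto_iff
  proof (intro allI impI)
    fix e :: real assume "e > 0"
    then obtain n where n: "1 / Suc n < e" using nat_approx_posE by blast
    have "x \<notin> ?E n" using x by blast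
    then obtain d where d: "d > 0" and
      less: "\<And>y. y \<in> I01 \<Longrightarrow> y \<noteq> x \<Longrightarrow> \<bar>y - x\<bar> < d \<Longrightarrow>
        \<bar>F y - F x - (y - x) * f x\<bar> < 1 / Suc n * \<bar>y - x\<bar>"
      using x(1) by (force simp: not_le)
    show "\<forall>\<^sub>F y in at x within I01. dist ((F y - F x) / (y - x)) (f x) < e"
      unfolding eventually_at
    proof (intro exI[of _ d] conjI ballI impI d)
      fix y assume y: "y \<in> I01" "y \<noteq> x \<and> dist y x < d"
      then have "\<bar>F y - F x - (y - x) * f x\<bar> < 1 / Suc n * \<bar>y - x\<bar>"
        using less[of y] by (simp add: dist_real_def)
      also have "\<dots> \<le> e * \<bar>y - x\<bar>" using n by (intro mult_right_mono) auto
      finally have "\<bar>F y - F x - (y - x) * f x\<bar> / \<bar>y - x\<bar> < e"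
        using y by (simp add: divide_less_eq)
      moreover have "(F y - F x) / (y - x) - f x = (F y - F x - (y - x) * f x) / (y - x)"
        using y by (simp add: field_simps)
      ultimately show "dist ((F y - F x) / (y - x)) (f x) < e"
        by (simp add: dist_real_def abs_divide)
    qed
  qed
  have "AE x in lebesgue. x \<notin> (\<Union>n. ?E n)" by (rule AE_not_in[OF null])
  then have "AE x in lebesgue. x \<in> I01 \<longrightarrow> (F has_real_derivative f x) (at x within I01)"
    by eventually_elim (use der in blast)
  then show ?thesis by (subst AE_restrict_space_iff) auto
qed

section \<open>The Volterra equation with a parameter\<close>

lemma continuous_on_weighted_integral:
  fixes p :: "real \<Rightarrow> real" and g :: "'a::metric_space \<Rightarrow> real \<Rightarrow> real"
  assumes p: "p absolutely_integrable_on I01"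
    and g: "continuous_on (S \<times> I01) (\<lambda>(x, s). g x s)"
    and B: "\<And>x s. x \<in> S \<Longrightarrow> s \<in> I01 \<Longrightarrow> \<bar>g x s\<bar> \<le> B"
  shows "continuous_on S (\<lambda>x. integral I01 (\<lambda>s. g x s * p s))"
  unfolding continuous_on_sequentially comp_def
proof (intro allI ballI impI)
  fix x a assume a: "a \<in> S" and x: "(\<forall>n. x n \<in> S) \<and> x \<longlonglongrightarrow> a"
  have slice: "continuous_on I01 (g y)" if "y \<in> S" for y
    by (rule continuous_on_section[OF g that])
  show "(\<lambda>n. integral I01 (\<lambda>s. g (x n) s * p s)) \<longlonglongrightarrow> integral I01 (\<lambda>s. g a s * p s)"
  proof (rule dominated_convergence(2)[where h = "\<lambda>s. B * \<bar>p s\<bar>"])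
    fix n
    have "(\<lambda>s. g (x n) s * p s) absolutely_integrable_on I01"
      by (rule abs_int_continuous_mult[OF p slice]) (use x in auto)
    then show "(\<lambda>s. g (x n) s * p s) integrable_on I01" by (auto simp: absolutely_integrable_on_def)
    fix s :: real assume "s \<in> I01"
    then show "norm (g (x n) s * p s) \<le> B * \<bar>p s\<bar>"
      using B[of "x n" s] x by (auto simp: abs_mult intro!: mult_right_mono)
  next
    show "(\<lambda>s. B * \<bar>p s\<bar>) integrable_on I01"
      using absolutely_integrable_norm[OF p]
      by (intro integrable_on_mult_right) (simp add: comp_def absolutely_integrable_on_def)
  next
    fix s :: real assume s: "s \<in> I01"
    have "(\<lambda>n. (\<lambda>(x, s). g x s) (x n, s)) \<longlonglongrightarrow> (\<lambda>(x, s). g x s) (a, s)"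
      by (rule continuous_on_tendsto_compose[OF g])
        (use x a s in \<open>auto intro!: tendsto_intros\<close>)
    then show "(\<lambda>n. g (x n) s * p s) \<longlonglongrightarrow> g a s * p s" by (auto intro!: tendsto_intros)
  qed
qed

definition clamp_to :: "real \<Rightarrow> real \<Rightarrow> real \<Rightarrow> real" where
  "clamp_to l r t = max l (min r t)"

lemma continuous_clamp_to [continuous_intros]:
  "continuous_on S f \<Longrightarrow> continuous_on S (\<lambda>x. clamp_to l r (f x))"
  unfolding clamp_to_def by (intro continuous_intros)

lemma clamp_to_in: "l \<le> r \<Longrightarrow> clamp_to l r t \<in> {l..r}"
  by (auto simp: clamp_to_def)

lemma clamp_to_id: "t \<in> {l..r} \<Longrightarrow> clamp_to l r t = t"
  by (auto simp: clamp_to_def)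

text \<open>The kernel \<open>t - s\<close> of the Volterra equation for \<open>u'' = - q u\<close>, after the unknown has been
  multiplied by the weight \<open>exp (- K t)\<close>. It is extended by \<open>0\<close> to \<open>t < s\<close>, so that integrals up
  to \<open>t\<close> become integrals over the whole unit interval with a continuous kernel.\<close>

definition volterra_kernel :: "real \<Rightarrow> real \<Rightarrow> real" where
  "volterra_kernel K \<tau> = max \<tau> 0 * exp (- (K * max \<tau> 0))"

lemma volterra_kernel_continuous [continuous_intros]:
  "continuous_on S f \<Longrightarrow> continuous_on S (\<lambda>x. volterra_kernel K (f x))"
  unfolding volterra_kernel_def by (intro continuous_intros)

lemma volterra_kernel_bound:
  assumes "K > 0" shows "0 \<le> volterra_kernel K \<tau>" "volterra_kernel K \<tau> \<le> 1 / K"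
proof -
  let ?m = "max \<tau> 0"
  have "K * ?m \<le> exp (K * ?m)" using exp_ge_add_one_self[of "K * ?m"] by linarith
  then have "?m \<le> exp (K * ?m) / K" using assms by (simp only: pos_le_divide_eq mult.commute)
  then have "?m * exp (- (K * ?m)) \<le> exp (K * ?m) / K * exp (- (K * ?m))"
    by (intro mult_right_mono) auto
  also have "\<dots> = 1 / K" by (simp add: exp_minus)
  finally show "volterra_kernel K \<tau> \<le> 1 / K" by (simp add: volterra_kernel_def)
  show "0 \<le> volterra_kernel K \<tau>" by (simp add: volterra_kernel_def)
qed

lemma continuous_on_bcontfun_compose:
  assumes "continuous_on S f"
  shows "continuous_on S (\<lambda>x. apply_bcontfun w (f x))"
  using continuous_on_compose2[OF continuous_on_apply_bcontfun[of UNIV w] assms] by auto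

text \<open>In the weighted unknown \<open>w \<mu> t = exp (- K t) u \<mu> t\<close> the integral operator is a contraction
  on bounded continuous functions of both variables, because its kernel is at most \<open>1 / K\<close> and
  \<open>a + \<mu>\<close> has \<open>L\<^sup>1\<close> norm at most \<open>\<parallel>a\<parallel> + R\<close>. Treating the parameter as a second variable of the
  unknown gives joint continuity at no extra cost.\<close>

lemma volterra_solution_exists:
  fixes a :: "real \<Rightarrow> real" and R \<alpha> \<beta> :: real
  assumes a: "a absolutely_integrable_on I01" and R: "R \<ge> 0"
  obtains u :: "real \<Rightarrow> real \<Rightarrow> real" where
    "continuous_on ({-R..R} \<times> I01) (\<lambda>(\<mu>, t). u \<mu> t)"
    "\<And>\<mu> t. \<mu> \<in> {-R..R} \<Longrightarrow> t \<in> I01 \<Longrightarrow>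
       u \<mu> t = \<alpha> + \<beta> * t - integral {0..t} (\<lambda>s. (t - s) * ((a s + \<mu>) * u \<mu> s))"
proof -
  let ?A = "integral I01 (\<lambda>s. \<bar>a s\<bar>)"
  define K where "K = 2 * (?A + R) + 1"
  have aabs: "(\<lambda>s. \<bar>a s\<bar>) absolutely_integrable_on I01"
    by (rule abs_int_abs[OF a])
  have A0: "?A \<ge> 0" by (intro integral_nonneg) (use aabs in \<open>auto simp: absolutely_integrable_on_def\<close>)
  have K: "K > 0" using A0 R by (simp add: K_def)
  \<comment> \<open>Clamping both variables makes the operator act on functions on the whole plane, so that the
    contraction principle applies to a type of functions.\<close>
  define c where "c = clamp_to 0 1"
  define m where "m = clamp_to (-R) R"
  have c01: "c t \<in> I01" for t using clamp_to_in[of 0 1 t] by (simp add: c_def)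
  have mR: "\<bar>m t\<bar> \<le> R" for t using clamp_to_in[of "-R" R t] R by (auto simp: m_def)
  define k where "k = volterra_kernel K"
  have kb: "\<bar>k \<tau>\<bar> \<le> 1 / K" for \<tau> using volterra_kernel_bound[OF K, of \<tau>] by (simp add: k_def)
  define T :: "((real \<times> real) \<Rightarrow>\<^sub>C real) \<Rightarrow> real \<times> real \<Rightarrow> real" where
    "T w x = exp (- (K * c (snd x))) * (\<alpha> + \<beta> * c (snd x))
      - (integral I01 (\<lambda>s. k (c (snd x) - s) * apply_bcontfun w (fst x, s) * a s)
         + integral I01 (\<lambda>s. k (c (snd x) - s) * apply_bcontfun w (fst x, s) * m (fst x)))" for w x
  note wcont = continuous_on_bcontfun_compose
  have gcont: "continuous_on S (\<lambda>x. k (c (snd (fst x)) - snd x) * apply_bcontfun w (fst (fst x), snd x) * m (fst (fst x)))"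
     "continuous_on S (\<lambda>x. k (c (snd (fst x)) - snd x) * apply_bcontfun w (fst (fst x), snd x))"
    for S :: "((real \<times> real) \<times> real) set" and w
    unfolding k_def c_def m_def by (intro continuous_intros wcont)+
  have slice: "continuous_on I01 (\<lambda>s. k (c t - s) * apply_bcontfun w (\<mu>, s))" for t w \<mu>
    unfolding k_def
    by (intro continuous_intros wcont[where f = "\<lambda>s. (\<mu>, s)"])
  have gb: "\<bar>k (c t - s) * apply_bcontfun w (\<mu>, s)\<bar> \<le> 1 / K * norm w" for t s w \<mu>
    unfolding abs_mult using kb norm_bounded[of w] K by (intro mult_mono) auto
  have gb2: "\<bar>k (c t - s) * apply_bcontfun w (\<mu>, s) * m \<mu>\<bar> \<le> 1 / K * norm w * R" for t s w \<mu>
    by (subst abs_mult, intro mult_mono gb mR) (use K in auto)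
  have Tcont: "continuous_on UNIV (T w)" for w
  proof -
    have 1: "continuous_on UNIV (\<lambda>x. integral I01 (\<lambda>s. k (c (snd x) - s) * apply_bcontfun w (fst x, s) * a s))"
      by (rule continuous_on_weighted_integral[OF a _ gb])
        (use gcont(2) in \<open>simp add: case_prod_beta'\<close>)
    have 2: "continuous_on UNIV (\<lambda>x. integral I01 (\<lambda>s. k (c (snd x) - s) * apply_bcontfun w (fst x, s) * m (fst x) * 1))"
      by (rule continuous_on_weighted_integral[OF abs_int_continuous _ gb2])
        (use gcont(1) in \<open>simp_all add: case_prod_beta'\<close>)
    show ?thesis
      unfolding T_def using 1 2 unfolding c_def
      by (intro continuous_intros) (simp_all add: mult.assoc)
  qed
  have int1: "(\<lambda>s. k (c t - s) * apply_bcontfun w (\<mu>, s) * a s) integrable_on I01" for t w \<mu>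
    using abs_int_continuous_mult[OF a slice] by (auto simp: absolutely_integrable_on_def)
  have int2: "(\<lambda>s. k (c t - s) * apply_bcontfun w (\<mu>, s) * m \<mu>) integrable_on I01" for t w \<mu>
    by (intro integrable_continuous_real continuous_intros slice)
  have aint: "(\<lambda>s. C * \<bar>a s\<bar>) integrable_on I01" for C
    by (intro integrable_on_mult_right) (use aabs in \<open>auto simp: absolutely_integrable_on_def\<close>)
  have I1: "\<bar>integral I01 (\<lambda>s. k (c t - s) * apply_bcontfun w (\<mu>, s) * a s)\<bar> \<le> 1 / K * norm w * ?A" for t w \<mu>
  proof -
    have "\<bar>integral I01 (\<lambda>s. k (c t - s) * apply_bcontfun w (\<mu>, s) * a s)\<bar>
      \<le> integral I01 (\<lambda>s. (1 / K * norm w) * \<bar>a s\<bar>)"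
      by (rule abs_integral_bound[OF int1 aint]) (subst abs_mult, intro mult_right_mono gb, simp)
    then show ?thesis by simp
  qed
  have I2: "\<bar>integral I01 (\<lambda>s. k (c t - s) * apply_bcontfun w (\<mu>, s) * m \<mu>)\<bar> \<le> 1 / K * norm w * R" for t w \<mu>
  proof -
    have "\<bar>integral I01 (\<lambda>s. k (c t - s) * apply_bcontfun w (\<mu>, s) * m \<mu>)\<bar>
      \<le> integral I01 (\<lambda>s. 1 / K * norm w * R)"
      by (rule abs_integral_bound[OF int2 _ gb2]) auto
    then show ?thesis by simp
  qed
  have Tb: "bounded (range (T w))" for w
  proof -
    have "norm (T w x) \<le> (\<bar>\<alpha>\<bar> + \<bar>\<beta>\<bar>) + 1 / K * norm w * ?A + 1 / K * norm w * R" for x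
    proof -
      have "\<bar>\<beta> * c (snd x)\<bar> \<le> \<bar>\<beta>\<bar> * 1"
        unfolding abs_mult using c01[of "snd x"] by (intro mult_left_mono) auto
      then have "\<bar>\<alpha> + \<beta> * c (snd x)\<bar> \<le> \<bar>\<alpha>\<bar> + \<bar>\<beta>\<bar>" by linarith
      moreover have "exp (- (K * c (snd x))) \<le> 1" using c01[of "snd x"] K by simp
      ultimately have "\<bar>exp (- (K * c (snd x))) * (\<alpha> + \<beta> * c (snd x))\<bar> \<le> 1 * (\<bar>\<alpha>\<bar> + \<bar>\<beta>\<bar>)"
        unfolding abs_mult by (intro mult_mono) auto
      then show ?thesis
        unfolding T_def using I1[of "snd x" w "fst x"] I2[of "snd x" w "fst x"] by simp
    qed
    then show ?thesis unfolding bounded_iff by blast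
  qed
  define TT where "TT w = Bcontfun (T w)" for w
  have TT: "apply_bcontfun (TT w) = T w" for w
    unfolding TT_def by (rule Bcontfun_inverse) (simp add: bcontfun_def Tcont Tb)
  have "\<exists>!w. w \<in> UNIV \<and> TT w = w"
  proof (rule Banach_fix[where c = "1/2"])
    fix w w' :: "(real \<times> real) \<Rightarrow>\<^sub>C real"
    show "dist (TT w) (TT w') \<le> 1 / 2 * dist w w'"
    proof (rule dist_bound)
      fix x
      have "T w x - T w' x =
        - (integral I01 (\<lambda>s. k (c (snd x) - s) * apply_bcontfun (w - w') (fst x, s) * a s)
         + integral I01 (\<lambda>s. k (c (snd x) - s) * apply_bcontfun (w - w') (fst x, s) * m (fst x)))"
      proof -
        have "integral I01 (\<lambda>s. k (c (snd x) - s) * apply_bcontfun (w - w') (fst x, s) * a s)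
          = integral I01 (\<lambda>s. k (c (snd x) - s) * apply_bcontfun w (fst x, s) * a s)
            - integral I01 (\<lambda>s. k (c (snd x) - s) * apply_bcontfun w' (fst x, s) * a s)"
          by (subst Henstock_Kurzweil_Integration.integral_diff[OF int1 int1, symmetric])
            (simp add: algebra_simps)
        moreover have "integral I01 (\<lambda>s. k (c (snd x) - s) * apply_bcontfun (w - w') (fst x, s) * m (fst x))
          = integral I01 (\<lambda>s. k (c (snd x) - s) * apply_bcontfun w (fst x, s) * m (fst x))
            - integral I01 (\<lambda>s. k (c (snd x) - s) * apply_bcontfun w' (fst x, s) * m (fst x))"
          by (subst Henstock_Kurzweil_Integration.integral_diff[OF int2 int2, symmetric])
            (simp add: algebra_simps)
        ultimately show ?thesis unfolding T_def by simp
      qed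
      then have "\<bar>T w x - T w' x\<bar> \<le> 1 / K * norm (w - w') * ?A + 1 / K * norm (w - w') * R"
        using I1[of "snd x" "w - w'" "fst x"] I2[of "snd x" "w - w'" "fst x"] by linarith
      also have "\<dots> = (?A + R) / K * norm (w - w')"
        by (simp add: add_divide_distrib algebra_simps)
      also have "\<dots> \<le> 1 / 2 * norm (w - w')"
      proof (rule mult_right_mono)
        show "(?A + R) / K \<le> 1 / 2" using K by (simp add: divide_le_eq K_def)
      qed auto
      finally show "dist (apply_bcontfun (TT w) x) (apply_bcontfun (TT w') x) \<le> 1 / 2 * dist w w'"
        by (simp add: TT dist_norm)
    qed
  qed (auto simp: complete_UNIV)
  then obtain w where "TT w = w" by blast
  then have fp: "apply_bcontfun w x = T w x" for x using TT[of w] by simp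
  define u where "u \<mu> t = exp (K * t) * apply_bcontfun w (\<mu>, t)" for \<mu> t
  show ?thesis
  proof
    show "continuous_on ({-R..R} \<times> I01) (\<lambda>(\<mu>, t). u \<mu> t)"
      unfolding u_def case_prod_beta' by (intro continuous_intros wcont)
    fix \<mu> t :: real assume \<mu>: "\<mu> \<in> {-R..R}" and t: "t \<in> I01"
    have m: "m \<mu> = \<mu>" using clamp_to_id[OF \<mu>] by (simp add: m_def)
    have ct: "c t = t" using clamp_to_id[OF t] by (simp add: c_def)
    let ?f = "\<lambda>s. k (t - s) * apply_bcontfun w (\<mu>, s) * a s + k (t - s) * apply_bcontfun w (\<mu>, s) * \<mu>"
    have "apply_bcontfun w (\<mu>, t) = exp (- (K * t)) * (\<alpha> + \<beta> * t) - integral I01 ?f"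
      using fp[of "(\<mu>, t)"] Henstock_Kurzweil_Integration.integral_add[OF int1[of t w \<mu>] int2[of t w \<mu>]]
      by (simp add: T_def ct m)
    moreover have "exp (K * t) * (exp (- (K * t)) * x - y) = x - exp (K * t) * y" for x y
      by (simp add: right_diff_distrib mult.assoc[symmetric] exp_minus)
    ultimately have "u \<mu> t = \<alpha> + \<beta> * t - exp (K * t) * integral I01 ?f"
      unfolding u_def by (simp only:)
    also have "integral I01 ?f = integral {0..t} ?f"
    proof -
      have "?f integrable_on I01"
        using integrable_add[OF int1[of t w \<mu>] int2[of t w \<mu>]] by (simp add: ct m)
      then have "integral {0..t} ?f + integral {t..1} ?f = integral I01 ?f"
        using t by (intro Henstock_Kurzweil_Integration.integral_combine) auto
      moreover have "integral {t..1} ?f = integral {t..1} (\<lambda>_. 0)"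
        by (rule integral_cong) (simp add: k_def volterra_kernel_def)
      ultimately show ?thesis by simp
    qed
    also have "exp (K * t) * integral {0..t} ?f = integral {0..t} (\<lambda>s. exp (K * t) * ?f s)" by simp
    also have "\<dots> = integral {0..t} (\<lambda>s. (t - s) * ((a s + \<mu>) * u \<mu> s))"
    proof (rule integral_cong)
      fix s assume s: "s \<in> {0..t}"
      have "exp (K * t) * k (t - s) = (t - s) * exp (K * s)"
        using s by (simp add: k_def volterra_kernel_def right_diff_distrib exp_diff)
      then have "exp (K * t) * k (t - s) * (apply_bcontfun w (\<mu>, s) * (a s + \<mu>))
          = (t - s) * exp (K * s) * (apply_bcontfun w (\<mu>, s) * (a s + \<mu>))" by simp
      then show "exp (K * t) * ?f s = (t - s) * ((a s + \<mu>) * u \<mu> s)"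
        unfolding u_def by (simp add: algebra_simps)
    qed
    finally show "u \<mu> t = \<alpha> + \<beta> * t - integral {0..t} (\<lambda>s. (t - s) * ((a s + \<mu>) * u \<mu> s))" .
  qed
qed

section \<open>Solutions in integrated form and uniqueness of Green functions\<close>

text \<open>\<open>u\<close> solves \<open>u'' + q u = \<sigma>\<close> in integrated form, with \<open>u1\<close> for \<open>u'\<close>.\<close>

definition weak_sol where
  "weak_sol q \<sigma> u u1 \<longleftrightarrow> C1_on_I u u1 \<and> primitive u1 (\<lambda>t. \<sigma> t - q t * u t)"

lemma C1_lincomb:
  assumes "C1_on_I u u1" "C1_on_I v v1"
  shows "C1_on_I (\<lambda>t. \<alpha> * u t + \<beta> * v t) (\<lambda>t. \<alpha> * u1 t + \<beta> * v1 t)"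
  using assms unfolding C1_on_I_def by (auto intro!: continuous_intros derivative_eq_intros)

lemma weak_sol_lincomb:
  assumes "weak_sol q \<sigma> u u1" "weak_sol q \<tau> v v1"
  shows "weak_sol q (\<lambda>t. \<alpha> * \<sigma> t + \<beta> * \<tau> t) (\<lambda>t. \<alpha> * u t + \<beta> * v t) (\<lambda>t. \<alpha> * u1 t + \<beta> * v1 t)"
  unfolding weak_sol_def
proof
  show "C1_on_I (\<lambda>t. \<alpha> * u t + \<beta> * v t) (\<lambda>t. \<alpha> * u1 t + \<beta> * v1 t)"
    using assms by (simp add: weak_sol_def C1_lincomb)
  have "primitive (\<lambda>t. \<alpha> * u1 t + \<beta> * v1 t) (\<lambda>t. \<alpha> * (\<sigma> t - q t * u t) + \<beta> * (\<tau> t - q t * v t))"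
    using assms by (intro primitive_add primitive_cmult) (auto simp: weak_sol_def)
  then show "primitive (\<lambda>t. \<alpha> * u1 t + \<beta> * v1 t)
      (\<lambda>t. (\<alpha> * \<sigma> t + \<beta> * \<tau> t) - q t * (\<alpha> * u t + \<beta> * v t))"
    by (rule primitive_cong) (simp_all add: algebra_simps)
qed

text \<open>By the product rule, \<open>t \<integral>\<^sub>0\<^sup>t g - \<integral>\<^sub>0\<^sup>t s g(s) ds\<close> has the density \<open>\<integral>\<^sub>0\<^sup>t g\<close>.\<close>

lemma volterra_imp_weak_sol:
  assumes q: "q absolutely_integrable_on I01" and u: "continuous_on I01 u"
    and eq: "\<And>t. t \<in> I01 \<Longrightarrow> u t = \<alpha> + \<beta> * t - integral {0..t} (\<lambda>s. (t - s) * (q s * u s))"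
  shows "weak_sol q (\<lambda>_. 0) u (\<lambda>t. \<beta> - integral {0..t} (\<lambda>s. q s * u s))"
proof -
  let ?g = "\<lambda>s. q s * u s"
  let ?v = "\<lambda>t. integral {0..t} ?g"
  have g: "?g absolutely_integrable_on I01"
    using abs_int_continuous_mult[OF q u] by (simp add: mult.commute)
  have pv: "primitive ?v ?g" using primitive_integral[OF g, of 0] by simp
  have id: "C1_on_I (\<lambda>t. t) (\<lambda>_. 1)" by (auto simp: C1_on_I_def)
  have sg: "(\<lambda>s. s * ?g s) absolutely_integrable_on I01"
    by (rule abs_int_continuous_mult[OF g]) (intro continuous_intros)
  have p1: "primitive (\<lambda>t. t * ?v t) (\<lambda>t. 1 * ?v t + t * ?g t)" by (rule primitive_mult[OF id pv])
  have p2: "primitive (\<lambda>t. integral {0..t} (\<lambda>s. s * ?g s)) (\<lambda>t. t * ?g t)"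
    using primitive_integral[OF sg, of 0] by simp
  have p3: "primitive (\<lambda>t. \<alpha> + \<beta> * t) (\<lambda>_. \<beta>)"
    by (rule C1_imp_primitive) (auto simp: C1_on_I_def intro!: derivative_eq_intros)
  have "primitive u (\<lambda>t. \<beta> - ?v t)"
  proof (rule primitive_cong[OF primitive_add[OF p3 primitive_cmult[OF primitive_add[OF p1
          primitive_cmult[OF p2, of "-1"]], of "-1"]]])
    fix t :: real assume t: "t \<in> I01"
    have i1: "(\<lambda>s. t * ?g s) integrable_on {0..t}"
      using t by (intro integrable_on_mult_right integrable_subinterval_I01 g) auto
    have i2: "(\<lambda>s. s * ?g s) integrable_on {0..t}"
      using t by (intro integrable_subinterval_I01 sg) auto
    have "integral {0..t} (\<lambda>s. (t - s) * ?g s) = integral {0..t} (\<lambda>s. t * ?g s) - integral {0..t} (\<lambda>s. s * ?g s)"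
      by (subst Henstock_Kurzweil_Integration.integral_diff[OF i1 i2, symmetric]) (simp add: left_diff_distrib)
    then show "\<alpha> + \<beta> * t + - 1 * (t * ?v t + - 1 * integral {0..t} (\<lambda>s. s * ?g s)) = u t"
      using eq[OF t] by simp
  qed auto
  moreover have "continuous_on I01 (\<lambda>t. \<beta> - ?v t)"
    by (intro continuous_intros primitive_continuous[OF pv])
  ultimately have "C1_on_I u (\<lambda>t. \<beta> - ?v t)" by (rule continuous_density_imp_C1)
  moreover have "primitive (\<lambda>t. \<beta> - ?v t) (\<lambda>t. 0 - q t * u t)"
  proof (rule primitive_cong)
    have "C1_on_I (\<lambda>_. \<beta>) (\<lambda>_. 0)" by (auto simp: C1_on_I_def)
    then show "primitive (\<lambda>t. \<beta> + - 1 * ?v t) (\<lambda>t. 0 + - 1 * ?g t)"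
      by (intro primitive_add primitive_cmult pv C1_imp_primitive)
  qed auto
  ultimately show ?thesis by (simp add: weak_sol_def)
qed

lemma wronskian_constant:
  assumes u: "weak_sol q (\<lambda>_. 0) u u1" and v: "weak_sol q (\<lambda>_. 0) v v1" and t: "t \<in> I01"
  shows "u t * v1 t - v t * u1 t = u 0 * v1 0 - v 0 * u1 0"
proof -
  have "primitive (\<lambda>t. u t * v1 t + - 1 * (v t * u1 t))
      (\<lambda>t. (u1 t * v1 t + u t * (0 - q t * v t)) + - 1 * (v1 t * u1 t + v t * (0 - q t * u t)))"
    using u v by (intro primitive_add primitive_cmult primitive_mult) (auto simp: weak_sol_def)
  then have "primitive (\<lambda>t. u t * v1 t - v t * u1 t) (\<lambda>_. 0)"
    by (rule primitive_cong) (simp_all add: algebra_simps)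
  from primitive_eq[OF this t] show ?thesis by simp
qed

lemma deriv_I_eq:
  assumes "(u has_real_derivative d) (at t within I01)" "t \<in> I01"
  shows "deriv_I u t = d"
  unfolding deriv_I_def
  using vector_derivative_within_cbox[of 0 1 t u d] assms
  by (simp add: has_real_derivative_iff_has_vector_derivative)

lemma deriv_I_works:
  assumes "u differentiable (at t within I01)"
  shows "(u has_real_derivative deriv_I u t) (at t within I01)"
  using assms vector_derivative_works
  by (auto simp: deriv_I_def has_real_derivative_iff_has_vector_derivative)

lemma abs_continuous_on_cong:
  assumes "\<And>t. t \<in> S \<Longrightarrow> f t = g t"
  shows "abs_continuous_on S f \<longleftrightarrow> abs_continuous_on S g"
proof -
  have "(\<Sum>(x, y)\<in>P. \<bar>f y - f x\<bar>) = (\<Sum>(x, y)\<in>P. \<bar>g y - g x\<bar>)"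
    if "\<forall>(x, y)\<in>P. x \<le> y \<and> {x..y} \<subseteq> S" for P
  proof (rule sum.cong[OF refl])
    fix i assume i: "i \<in> P"
    obtain x y where xy: "i = (x, y)" by fastforce
    then have "x \<in> S" "y \<in> S" using that i by force+
    then show "(case i of (x, y) \<Rightarrow> \<bar>f y - f x\<bar>) = (case i of (x, y) \<Rightarrow> \<bar>g y - g x\<bar>)"
      using assms xy by simp
  qed
  then show ?thesis unfolding abs_continuous_on_def by (smt (verit, best))
qed

lemma abs_continuous_on_diff:
  assumes f: "abs_continuous_on S f" and g: "abs_continuous_on S g"
  shows "abs_continuous_on S (\<lambda>t. f t - g t)"
  unfolding abs_continuous_on_def
proof (intro allI impI)
  fix e :: real assume "e > 0"
  then have e2: "e / 2 > 0" by simp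
  obtain d1 where d1: "d1 > 0" "\<And>P. finite P \<Longrightarrow> (\<forall>(x, y)\<in>P. x \<le> y \<and> {x..y} \<subseteq> S) \<Longrightarrow>
      disjoint_family_on (\<lambda>(x, y). {x<..<y}) P \<Longrightarrow> (\<Sum>(x, y)\<in>P. y - x) < d1 \<Longrightarrow>
      (\<Sum>(x, y)\<in>P. \<bar>f y - f x\<bar>) < e / 2"
    using f e2 unfolding abs_continuous_on_def by meson
  obtain d2 where d2: "d2 > 0" "\<And>P. finite P \<Longrightarrow> (\<forall>(x, y)\<in>P. x \<le> y \<and> {x..y} \<subseteq> S) \<Longrightarrow>
      disjoint_family_on (\<lambda>(x, y). {x<..<y}) P \<Longrightarrow> (\<Sum>(x, y)\<in>P. y - x) < d2 \<Longrightarrow>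
      (\<Sum>(x, y)\<in>P. \<bar>g y - g x\<bar>) < e / 2"
    using g e2 unfolding abs_continuous_on_def by meson
  show "\<exists>d>0. \<forall>P. finite P \<longrightarrow> (\<forall>(x, y)\<in>P. x \<le> y \<and> {x..y} \<subseteq> S) \<longrightarrow>
      disjoint_family_on (\<lambda>(x, y). {x<..<y}) P \<longrightarrow> (\<Sum>(x, y)\<in>P. y - x) < d \<longrightarrow>
      (\<Sum>(x, y)\<in>P. \<bar>f y - g y - (f x - g x)\<bar>) < e"
  proof (intro exI[of _ "min d1 d2"] conjI allI impI)
    fix P assume P: "finite P" "\<forall>(x, y)\<in>P. x \<le> y \<and> {x..y} \<subseteq> S"
      "disjoint_family_on (\<lambda>(x, y). {x<..<y}) P" "(\<Sum>(x, y)\<in>P. y - x) < min d1 d2"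
    have "(\<Sum>(x, y)\<in>P. \<bar>f y - g y - (f x - g x)\<bar>) \<le> (\<Sum>(x, y)\<in>P. \<bar>f y - f x\<bar> + \<bar>g y - g x\<bar>)"
      by (rule sum_mono) (auto simp: case_prod_beta')
    also have "\<dots> = (\<Sum>(x, y)\<in>P. \<bar>f y - f x\<bar>) + (\<Sum>(x, y)\<in>P. \<bar>g y - g x\<bar>)"
      by (simp add: case_prod_beta' sum.distrib)
    also have "\<dots> < e" using d1(2)[OF P(1-3)] d2(2)[OF P(1-3)] P(4) by simp
    finally show "(\<Sum>(x, y)\<in>P. \<bar>f y - g y - (f x - g x)\<bar>) < e" .
  qed (use d1 d2 in auto)
qed

lemma weak_sol_deriv_I:
  assumes "weak_sol q \<sigma> u u1" "t \<in> I01"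
  shows "deriv_I u t = u1 t"
  using assms by (intro deriv_I_eq) (auto simp: weak_sol_def C1_on_I_def)

lemma weak_sol_W21:
  assumes u: "weak_sol q \<sigma> u u1"
  shows "u \<in> W21"
proof -
  have C1: "C1_on_I u u1" and p: "primitive u1 (\<lambda>t. \<sigma> t - q t * u t)" using u by (auto simp: weak_sol_def)
  have "u differentiable_on I01"
    using C1 unfolding C1_on_I_def differentiable_on_def real_differentiable_def by blast
  moreover have "abs_continuous_on I01 (deriv_I u)"
    using primitive_abs_continuous[OF p] abs_continuous_on_cong[of I01 "deriv_I u" u1]
      weak_sol_deriv_I[OF u] by blast
  ultimately show ?thesis using C1_continuous[OF C1] by (simp add: W21_def)
qed

lemma weak_sol_L_eq_ae:
  assumes u: "weak_sol (\<lambda>t. a t + lam) \<sigma> u u1"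
  shows "L_eq_ae a lam u \<sigma>"
proof -
  have p: "primitive u1 (\<lambda>t. \<sigma> t - (a t + lam) * u t)" using u by (auto simp: weak_sol_def)
  have "AE t in lebesgue_on I01. t \<in> I01" by (rule AE_I2) simp
  with primitive_AE_derivative[OF p] show ?thesis
    unfolding L_eq_ae_def
  proof eventually_elim
    fix t :: real
    assume der: "(u1 has_real_derivative \<sigma> t - (a t + lam) * u t) (at t within I01)" and t: "t \<in> I01"
    have d: "(deriv_I u has_real_derivative \<sigma> t - (a t + lam) * u t) (at t within I01)"
      by (rule has_field_derivative_transform_within[OF der zero_less_one t])
        (simp add: weak_sol_deriv_I[OF u])
    then have "deriv_I u differentiable (at t within I01)"
      using real_differentiable_def by blast
    with deriv_I_eq[OF d t] show "deriv_I u differentiable (at t within I01) \<and> L_op a lam u t = \<sigma> t"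
      by (simp add: L_op_def)
  qed
qed

lemma weak_sol_X_D: "weak_sol q \<sigma> u u1 \<Longrightarrow> u 0 = 0 \<Longrightarrow> u 1 = 0 \<Longrightarrow> u \<in> X_D"
  by (simp add: X_D_def weak_sol_W21)

lemma weak_sol_X_P: "weak_sol q \<sigma> u u1 \<Longrightarrow> u 0 = u 1 \<Longrightarrow> u1 0 = u1 1 \<Longrightarrow> u \<in> X_P"
  by (simp add: X_P_def weak_sol_W21 weak_sol_deriv_I)

lemma W21_derivative:
  assumes "u \<in> W21" "t \<in> I01"
  shows "(u has_real_derivative deriv_I u t) (at t within I01)"
  using assms by (intro deriv_I_works) (auto simp: W21_def differentiable_on_def)

lemma deriv_I_diff:
  assumes "u \<in> W21" "v \<in> W21" "t \<in> I01"
  shows "deriv_I (\<lambda>t. u t - v t) t = deriv_I u t - deriv_I v t"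
  by (rule deriv_I_eq[OF DERIV_diff]) (use assms W21_derivative in auto)

lemma W21_diff:
  assumes "u \<in> W21" "v \<in> W21"
  shows "(\<lambda>t. u t - v t) \<in> W21"
proof -
  have "abs_continuous_on I01 (deriv_I (\<lambda>t. u t - v t))"
    using abs_continuous_on_diff[of I01 "deriv_I u" "deriv_I v"] assms
      abs_continuous_on_cong[where S = I01 and f = "deriv_I (\<lambda>t. u t - v t)", OF deriv_I_diff[OF assms]]
    by (simp add: W21_def)
  then show ?thesis using assms by (simp add: W21_def continuous_on_diff differentiable_on_diff)
qed

lemma boundary_space_diff:
  assumes "X = X_D \<or> X = X_P" "u \<in> X" "v \<in> X"
  shows "(\<lambda>t. u t - v t) \<in> X"
  using assms by (auto simp: X_D_def X_P_def W21_diff deriv_I_diff)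

lemma L_eq_ae_diff:
  assumes uW: "u \<in> W21" and vW: "v \<in> W21" and u: "L_eq_ae a lam u \<sigma>" and v: "L_eq_ae a lam v \<tau>"
  shows "L_eq_ae a lam (\<lambda>t. u t - v t) (\<lambda>t. \<sigma> t - \<tau> t)"
proof -
  have "AE t in lebesgue_on I01. t \<in> I01" by (rule AE_I2) simp
  with u v show ?thesis
    unfolding L_eq_ae_def
  proof eventually_elim
    fix t :: real
    assume A: "deriv_I u differentiable (at t within I01) \<and> L_op a lam u t = \<sigma> t"
      and B: "deriv_I v differentiable (at t within I01) \<and> L_op a lam v t = \<tau> t" and t: "t \<in> I01"
    have "((\<lambda>t. deriv_I u t - deriv_I v t) has_real_derivative
        deriv_I (deriv_I u) t - deriv_I (deriv_I v) t) (at t within I01)"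
      using A B by (intro DERIV_diff deriv_I_works) auto
    then have d: "(deriv_I (\<lambda>t. u t - v t) has_real_derivative
        deriv_I (deriv_I u) t - deriv_I (deriv_I v) t) (at t within I01)"
      by (rule has_field_derivative_transform_within[OF _ zero_less_one t])
        (simp add: deriv_I_diff[OF uW vW])
    then have "deriv_I (\<lambda>t. u t - v t) differentiable (at t within I01)"
      using real_differentiable_def by blast
    with deriv_I_eq[OF d t] A B
    show "deriv_I (\<lambda>t. u t - v t) differentiable (at t within I01)
        \<and> L_op a lam (\<lambda>t. u t - v t) t = \<sigma> t - \<tau> t"
      by (auto simp: L_op_def algebra_simps)
  qed
qed

lemma nonresonant_unique:
  assumes "nonresonant a lam X" "X = X_D \<or> X = X_P" "u \<in> X" "v \<in> X"
    and "L_eq_ae a lam u \<sigma>" "L_eq_ae a lam v \<sigma>" "t \<in> I01"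
  shows "u t = v t"
proof -
  have "u \<in> W21" "v \<in> W21" using assms(2-4) by (auto simp: X_D_def X_P_def)
  then have "L_eq_ae a lam (\<lambda>t. u t - v t) (\<lambda>t. \<sigma> t - \<sigma> t)" using assms by (intro L_eq_ae_diff)
  then have "L_eq_ae a lam (\<lambda>t. u t - v t) (\<lambda>_. 0)" by simp
  then have "u t - v t = 0"
    using assms(1,7) boundary_space_diff[OF assms(2-4)] unfolding nonresonant_def by blast
  then show ?thesis by simp
qed

text \<open>Testing with continuous right-hand sides is enough: \<open>G t - E t\<close> is itself continuous, so it
  can be used as \<open>\<sigma>\<close>, and nonresonance turns equality of the two solutions into
  \<open>\<integral> (G t s - E t s)\<^sup>2 ds = 0\<close>. For continuous \<open>\<sigma>\<close> the construction of the explicit kernels uses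
  only products with a \<open>C\<^sup>1\<close> factor.\<close>

lemma Green_function_unique:
  fixes E :: "real \<Rightarrow> real \<Rightarrow> real"
  assumes G: "is_Green_function a lam X G" and X: "X = X_D \<or> X = X_P"
    and E: "\<And>t. t \<in> I01 \<Longrightarrow> continuous_on I01 (E t)"
    and sol: "\<And>\<sigma>. continuous_on I01 \<sigma> \<Longrightarrow> \<exists>w\<in>X. L_eq_ae a lam w \<sigma> \<and>
        (\<forall>t\<in>I01. w t = integral I01 (\<lambda>s. E t s * \<sigma> s))"
    and t: "t \<in> I01" and s: "s \<in> I01"
  shows "G t s = E t s"
proof -
  have Gc: "continuous_on I01 (G t)"
    using G t continuous_on_section[of I01 I01 G t] by (simp add: is_Green_function_def)
  define \<sigma> where "\<sigma> s = G t s - E t s" for s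
  have \<sigma>: "continuous_on I01 \<sigma>" unfolding \<sigma>_def by (intro continuous_intros Gc E t)
  obtain w where w: "w \<in> X" "L_eq_ae a lam w \<sigma>" "\<And>t. t \<in> I01 \<Longrightarrow> w t = integral I01 (\<lambda>s. E t s * \<sigma> s)"
    using sol[OF \<sigma>] by blast
  define u where "u = (\<lambda>t. LINT s:I01|lebesgue. G t s * \<sigma> s)"
  have u: "u \<in> X" "L_eq_ae a lam u \<sigma>"
    using G abs_int_continuous[OF \<sigma>] unfolding is_Green_function_def u_def Let_def by blast+
  have i1: "(\<lambda>s. G t s * \<sigma> s) absolutely_integrable_on I01"
    and i2: "(\<lambda>s. E t s * \<sigma> s) absolutely_integrable_on I01"
    by (intro abs_int_continuous continuous_intros Gc E t \<sigma>)+
  have "u t = integral I01 (\<lambda>s. G t s * \<sigma> s)"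
    unfolding u_def by (rule set_lebesgue_integral_eq_integral(2)[OF i1])
  moreover have "u t = w t"
    using G by (intro nonresonant_unique[OF _ X u(1) w(1) u(2) w(2) t]) (simp add: is_Green_function_def)
  ultimately have "integral I01 (\<lambda>s. G t s * \<sigma> s - E t s * \<sigma> s) = 0"
    using w(3)[OF t] i1 i2 by (subst Henstock_Kurzweil_Integration.integral_diff)
      (auto simp: absolutely_integrable_on_def)
  moreover have "(\<lambda>s. G t s * \<sigma> s - E t s * \<sigma> s) = (\<lambda>s. (\<sigma> s)\<^sup>2)"
    by (auto simp: \<sigma>_def power2_eq_square algebra_simps)
  ultimately have "integral I01 (\<lambda>s. (\<sigma> s)\<^sup>2) = 0" by simp
  moreover have c2: "continuous_on I01 (\<lambda>s. (\<sigma> s)\<^sup>2)" by (intro continuous_intros \<sigma>)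
  ultimately have "((\<lambda>s. (\<sigma> s)\<^sup>2) has_integral 0) (cbox 0 1)"
    using integrable_integral[OF integrable_continuous_real[OF c2]] by simp
  then have "(\<sigma> s)\<^sup>2 = 0"
    using c2 s by (intro has_integral_0_cbox_imp_0) (auto simp: cbox_interval)
  then show ?thesis by (simp add: \<sigma>_def)
qed

section \<open>Explicit Green functions\<close>

locale fundamental_system =
  fixes q \<phi> \<phi>1 \<psi> \<psi>1 :: "real \<Rightarrow> real"
  assumes phi: "weak_sol q (\<lambda>_. 0) \<phi> \<phi>1" and psi: "weak_sol q (\<lambda>_. 0) \<psi> \<psi>1"
    and phi0: "\<phi> 0 = 1" "\<phi>1 0 = 0" and psi0: "\<psi> 0 = 0" "\<psi>1 0 = 1"
begin

lemma wronskian: "t \<in> I01 \<Longrightarrow> \<phi> t * \<psi>1 t - \<psi> t * \<phi>1 t = 1"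
  using wronskian_constant[OF phi psi] by (simp add: phi0 psi0)

text \<open>Hill's discriminant, the trace of the monodromy matrix. As the matrix has determinant \<open>1\<close>,
  it has the eigenvalue \<open>1\<close> exactly when the trace is \<open>2\<close>.\<close>

definition discriminant :: real where
  "discriminant = \<phi> 1 + \<psi>1 1"

lemma weak_sol_combination:
  "weak_sol q (\<lambda>_. 0) (\<lambda>t. \<alpha> * \<phi> t + \<beta> * \<psi> t) (\<lambda>t. \<alpha> * \<phi>1 t + \<beta> * \<psi>1 t)"
  using weak_sol_lincomb[OF phi psi, of \<alpha> \<beta>] by simp

lemma discriminant_2_imp_periodic_solution:
  assumes D: "discriminant = 2"
  shows "\<exists>u u1. weak_sol q (\<lambda>_. 0) u u1 \<and> u \<in> X_P \<and> (\<exists>t\<in>I01. u t \<noteq> 0)"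
proof -
  have W: "\<phi> 1 * \<psi>1 1 - \<psi> 1 * \<phi>1 1 = 1" by (rule wronskian) simp
  have "\<exists>\<alpha> \<beta>. (\<alpha> \<noteq> 0 \<or> \<beta> \<noteq> 0) \<and> \<alpha> * \<phi> 1 + \<beta> * \<psi> 1 = \<alpha> \<and> \<alpha> * \<phi>1 1 + \<beta> * \<psi>1 1 = \<beta>"
  \<comment> \<open>The first row of the monodromy matrix minus the identity is \<open>(\<phi> 1 - 1, \<psi> 1)\<close>. A vector orthogonal to it
    lies in the kernel; if the row vanishes, \<open>\<psi>\<close> itself is periodic.\<close>
  proof (cases "\<psi> 1 = 0 \<and> \<phi> 1 = 1")
    case True
    then show ?thesis using D by (intro exI[of _ 0] exI[of _ 1]) (simp add: discriminant_def)
  next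
    case False
    have "- \<psi> 1 * \<phi>1 1 + (\<phi> 1 - 1) * \<psi>1 1 = \<phi> 1 - 1"
      using W D by (simp add: discriminant_def algebra_simps)
    then show ?thesis
      using False by (intro exI[of _ "- \<psi> 1"] exI[of _ "\<phi> 1 - 1"]) (auto simp: algebra_simps)
  qed
  then obtain \<alpha> \<beta> where ab: "\<alpha> \<noteq> 0 \<or> \<beta> \<noteq> 0"
    and per: "\<alpha> * \<phi> 1 + \<beta> * \<psi> 1 = \<alpha>" "\<alpha> * \<phi>1 1 + \<beta> * \<psi>1 1 = \<beta>" by blast
  let ?u = "\<lambda>t. \<alpha> * \<phi> t + \<beta> * \<psi> t" and ?u1 = "\<lambda>t. \<alpha> * \<phi>1 t + \<beta> * \<psi>1 t"
  have u: "weak_sol q (\<lambda>_. 0) ?u ?u1" by (rule weak_sol_combination)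
  moreover have "?u \<in> X_P" by (rule weak_sol_X_P[OF u]) (simp_all add: per phi0 psi0)
  moreover have "\<exists>t\<in>I01. ?u t \<noteq> 0"
  proof (rule ccontr)
    assume "\<not> ?thesis"
    then have zero: "?u t = 0" if "t \<in> I01" for t using that by blast
    have "((\<lambda>_. 0) has_real_derivative 0) (at 0 within I01)" by simp
    then have "(?u has_real_derivative 0) (at 0 within I01)"
      by (rule has_field_derivative_transform_within[OF _ zero_less_one]) (simp_all add: zero)
    then have "deriv_I ?u 0 = 0" by (rule deriv_I_eq) simp
    then have "\<beta> = 0" using weak_sol_deriv_I[OF u, of 0] by (simp add: phi0 psi0)
    moreover have "\<alpha> = 0" using zero[of 0] by (simp add: phi0 psi0)
    ultimately show False using ab by simp
  qed
  ultimately show ?thesis by blast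
qed

text \<open>An interior zero of a nonnegative \<open>\<psi>\<close> would be a double zero, against the Wronskian. So the
  zero is at \<open>1\<close>, and there \<open>\<psi>' < 0\<close> and \<open>\<phi> \<psi>' = 1\<close>, so both terms of the trace are negative.\<close>

lemma first_zero_imp_discriminant_neg:
  assumes nonneg: "\<And>t. t \<in> I01 \<Longrightarrow> \<psi> t \<ge> 0" and \<tau>: "0 < \<tau>" "\<tau> \<le> 1" "\<psi> \<tau> = 0"
  shows "discriminant < 0"
proof -
  have der: "(\<psi> has_real_derivative \<psi>1 t) (at t within I01)" if "t \<in> I01" for t
    using psi that by (auto simp: weak_sol_def C1_on_I_def)
  have "\<tau> = 1"
  proof (rule ccontr)
    assume "\<tau> \<noteq> 1"
    then have t: "\<tau> \<in> {0<..<1}" using \<tau> by auto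
    then have "(\<psi> has_real_derivative \<psi>1 \<tau>) (at \<tau>)"
      using der[of \<tau>] at_within_Icc_at[of 0 \<tau> 1] by auto
    then have "\<psi>1 \<tau> = 0"
    proof (rule DERIV_local_min)
      show "0 < min \<tau> (1 - \<tau>)" using t by auto
      show "\<forall>y. \<bar>\<tau> - y\<bar> < min \<tau> (1 - \<tau>) \<longrightarrow> \<psi> \<tau> \<le> \<psi> y"
        unfolding \<tau>(3) by (intro allI impI nonneg) auto
    qed
    then show False using wronskian[of \<tau>] \<tau> t by simp
  qed
  then have zero: "\<psi> 1 = 0" using \<tau> by simp
  have "\<not> \<psi>1 1 > 0"
  proof
    assume "\<psi>1 1 > 0"
    then obtain d where d: "d > 0" "\<And>h. h > 0 \<Longrightarrow> 1 - h \<in> I01 \<Longrightarrow> h < d \<Longrightarrow> \<psi> (1 - h) < \<psi> 1"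
      using has_real_derivative_pos_inc_left[OF der[of 1]] by auto
    define h where "h = min (d / 2) (1 / 2)"
    have h: "h > 0" "1 - h \<in> I01" "h < d" using d(1) by (auto simp: h_def)
    show False using d(2)[OF h] zero nonneg[OF h(2)] by simp
  qed
  moreover have W: "\<phi> 1 * \<psi>1 1 = 1" using wronskian[of 1] zero by simp
  moreover have "\<psi>1 1 \<noteq> 0" using W by auto
  ultimately have "\<psi>1 1 < 0" by simp
  moreover from this W have "\<phi> 1 < 0" by (metis mult_less_0_iff not_less_iff_gr_or_eq zero_less_mult_iff zero_less_one)
  ultimately show ?thesis by (simp add: discriminant_def)
qed

text \<open>The solution with \<open>\<eta> 1 = 0\<close> and \<open>\<eta>' 1 = -1\<close>: the counterpart of \<open>\<psi>\<close> at the right end.\<close>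

definition \<eta> where "\<eta> t = \<psi> 1 * \<phi> t + - \<phi> 1 * \<psi> t"
definition \<eta>1 where "\<eta>1 t = \<psi> 1 * \<phi>1 t + - \<phi> 1 * \<psi>1 t"

lemma eta: "weak_sol q (\<lambda>_. 0) \<eta> \<eta>1"
  using weak_sol_combination[of "\<psi> 1" "- \<phi> 1"] by (simp add: \<eta>_def[abs_def] \<eta>1_def[abs_def])

lemma eta_boundary: "\<eta> 0 = \<psi> 1" "\<eta> 1 = 0" "\<eta>1 0 = - \<phi> 1" "\<eta>1 1 = - 1"
  using wronskian[of 1] by (auto simp: \<eta>_def \<eta>1_def phi0 psi0 algebra_simps)

lemma wronskian_psi_eta: "t \<in> I01 \<Longrightarrow> \<psi> t * \<eta>1 t - \<eta> t * \<psi>1 t = - \<psi> 1"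
  using wronskian_constant[OF psi eta] by (simp add: eta_boundary psi0)

lemma continuous_fundamental:
  "continuous_on I01 \<psi>" "continuous_on I01 \<psi>1" "continuous_on I01 \<eta>" "continuous_on I01 \<eta>1"
  using psi eta by (auto simp: weak_sol_def C1_on_I_def intro: C1_continuous)

end

locale positive_system = fundamental_system +
  assumes psi_pos: "\<And>t. 0 < t \<Longrightarrow> t \<le> 1 \<Longrightarrow> \<psi> t > 0"
begin

lemma psi1_pos: "\<psi> 1 > 0" by (simp add: psi_pos)

text \<open>By the Wronskian, \<open>(\<eta> / \<psi>)' = - \<psi> 1 / \<psi>\<^sup>2 < 0\<close>, and \<open>\<eta> / \<psi>\<close> vanishes at \<open>1\<close>.\<close>

lemma eta_pos:
  assumes "0 \<le> t" "t < 1"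
  shows "\<eta> t > 0"
proof (cases "t = 0")
  case True
  then show ?thesis by (simp add: eta_boundary psi1_pos)
next
  case False
  have "\<eta> 1 / \<psi> 1 < \<eta> t / \<psi> t"
  proof (rule DERIV_neg_imp_decreasing_open[OF assms(2)])
    fix x assume x: "t < x" "x < 1"
    have "at x within I01 = at x" using x assms by (intro at_within_Icc_at) auto
    moreover have "x \<in> I01" using x assms by auto
    ultimately have der: "(\<psi> has_real_derivative \<psi>1 x) (at x)" "(\<eta> has_real_derivative \<eta>1 x) (at x)"
      using psi eta unfolding weak_sol_def C1_on_I_def by metis+
    have px: "\<psi> x > 0" using psi_pos x assms by simp
    have "((\<lambda>t. \<eta> t / \<psi> t) has_real_derivative (\<eta>1 x * \<psi> x - \<eta> x * \<psi>1 x) / (\<psi> x * \<psi> x)) (at x)"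
      using px by (intro DERIV_divide der) simp
    moreover have "\<eta>1 x * \<psi> x - \<eta> x * \<psi>1 x = - \<psi> 1"
      using wronskian_psi_eta[of x] x assms by (simp add: mult.commute)
    moreover have "- \<psi> 1 / (\<psi> x * \<psi> x) < 0" using px psi1_pos by simp
    ultimately show "\<exists>y. ((\<lambda>t. \<eta> t / \<psi> t) has_real_derivative y) (at x) \<and> y < 0" by auto
  next
    show "continuous_on {t..1} (\<lambda>t. \<eta> t / \<psi> t)"
    proof (intro continuous_intros ballI)
      show "continuous_on {t..1} \<eta>" "continuous_on {t..1} \<psi>"
        using assms by (auto intro: continuous_on_subset[OF continuous_fundamental(1)]
          continuous_on_subset[OF continuous_fundamental(3)])
      fix x assume "x \<in> {t..1}"
      then show "\<psi> x \<noteq> 0" using psi_pos[of x] assms False by auto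
    qed
  qed
  moreover have "\<psi> t > 0" using psi_pos False assms by simp
  ultimately show ?thesis by (simp add: eta_boundary zero_less_divide_iff)
qed

text \<open>The homogeneous solution with value \<open>1\<close> at both ends. Adding multiples of it to a Dirichlet
  solution keeps the two boundary values equal, and the multiple is then chosen to match the
  slopes.\<close>

definition h where "h t = 1 / \<psi> 1 * \<psi> t + 1 / \<psi> 1 * \<eta> t"
definition h1 where "h1 t = 1 / \<psi> 1 * \<psi>1 t + 1 / \<psi> 1 * \<eta>1 t"

lemma h: "weak_sol q (\<lambda>_. 0) h h1"
  using weak_sol_lincomb[OF psi eta, of "1 / \<psi> 1" "1 / \<psi> 1"] by (simp add: h_def[abs_def] h1_def[abs_def])

lemma h_boundary: "h 0 = 1" "h 1 = 1"
  using psi1_pos by (auto simp: h_def eta_boundary psi0)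

lemma h_pos:
  assumes "t \<in> I01" shows "h t > 0"
proof -
  have "\<psi> t \<ge> 0" using psi_pos[of t] assms psi0 by (cases "t = 0") auto
  moreover have "\<eta> t \<ge> 0" using eta_pos[of t] assms eta_boundary by (cases "t = 1") auto
  moreover have "\<psi> t > 0 \<or> \<eta> t > 0" using psi_pos[of t] eta_pos[of t] assms by (cases "t = 0") auto
  ultimately have "(\<psi> t + \<eta> t) / \<psi> 1 > 0" using psi1_pos by auto
  then show ?thesis by (simp add: h_def add_divide_distrib)
qed

lemma h_slope_jump: "h1 1 - h1 0 = (discriminant - 2) / \<psi> 1"
  using psi1_pos by (simp add: h1_def eta_boundary psi0 discriminant_def diff_divide_distrib add_divide_distrib)

definition dirichlet_kernel where
  "dirichlet_kernel t s = - (\<eta> (max t s) * \<psi> (min t s)) / \<psi> 1"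

lemma dirichlet_kernel_neg:
  assumes "t \<in> {0<..<1}" "s \<in> {0<..<1}"
  shows "dirichlet_kernel t s < 0"
  using eta_pos[of "max t s"] psi_pos[of "min t s"] psi1_pos assms
  by (auto simp: dirichlet_kernel_def)

lemma continuous_dirichlet_kernel:
  assumes "t \<in> I01" shows "continuous_on I01 (dirichlet_kernel t)"
  unfolding dirichlet_kernel_def
proof (intro continuous_intros ballI)
  show "continuous_on I01 (\<lambda>x. \<eta> (max t x))"
    by (rule continuous_on_compose2[OF continuous_fundamental(3)])
      (use assms in \<open>auto intro!: continuous_intros\<close>)
  show "continuous_on I01 (\<lambda>x. \<psi> (min t x))"
    by (rule continuous_on_compose2[OF continuous_fundamental(1)])
      (use assms in \<open>auto intro!: continuous_intros\<close>)
qed (use psi1_pos in auto)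

text \<open>Variation of parameters: \<open>w = - (\<eta> A + \<psi> B) / \<psi> 1\<close> with \<open>A t = \<integral>\<^sub>0\<^sup>t \<psi> \<sigma>\<close> and
  \<open>B t = \<integral>\<^sub>t\<^sup>1 \<eta> \<sigma>\<close>. In the derivative the terms with \<open>A'\<close> and \<open>B'\<close> cancel, and in the second
  derivative they combine to the Wronskian of \<open>\<psi>\<close> and \<open>\<eta>\<close> times \<open>\<sigma>\<close>. The jump of \<open>w'\<close> is the
  quantity that the periodic problem has to correct.\<close>

lemma dirichlet_solution:
  assumes \<sigma>: "continuous_on I01 \<sigma>"
  defines "w \<equiv> \<lambda>t. integral I01 (\<lambda>s. dirichlet_kernel t s * \<sigma> s)"
  obtains w1 where "weak_sol q \<sigma> w w1" "w 0 = 0" "w 1 = 0"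
    "w1 1 - w1 0 = integral I01 (\<lambda>s. h s * \<sigma> s)"
proof -
  note cont = continuous_fundamental
  have f: "continuous_on I01 (\<lambda>s. \<psi> s * \<sigma> s)" and g: "continuous_on I01 (\<lambda>s. \<eta> s * \<sigma> s)"
    by (intro continuous_intros cont \<sigma>)+
  define A where "A t = integral {0..t} (\<lambda>s. \<psi> s * \<sigma> s)" for t
  define B where "B t = integral {t..1} (\<lambda>s. \<eta> s * \<sigma> s)" for t
  have pA: "primitive A (\<lambda>s. \<psi> s * \<sigma> s)"
    using primitive_integral[OF abs_int_continuous[OF f], of 0] by (simp add: A_def[abs_def])
  have pB: "primitive B (\<lambda>s. - 1 * (\<eta> s * \<sigma> s))"
  proof (rule primitiveI)
    show "(\<lambda>s. - 1 * (\<eta> s * \<sigma> s)) absolutely_integrable_on I01"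
      by (intro abs_int_continuous continuous_intros g)
    fix x y :: real assume xy: "0 \<le> x" "x \<le> y" "y \<le> 1"
    have "integral {x..y} (\<lambda>s. \<eta> s * \<sigma> s) + B y = B x"
      unfolding B_def using xy by (intro Henstock_Kurzweil_Integration.integral_combine
        integrable_subinterval_I01 abs_int_continuous g) auto
    then show "B y - B x = integral {x..y} (\<lambda>s. - 1 * (\<eta> s * \<sigma> s))" by simp
  qed
  have cA: "C1_on_I A (\<lambda>s. \<psi> s * \<sigma> s)" by (rule continuous_density_imp_C1[OF pA f])
  have cB: "C1_on_I B (\<lambda>s. - 1 * (\<eta> s * \<sigma> s))"
    by (rule continuous_density_imp_C1[OF pB]) (intro continuous_intros g)
  have C: "C1_on_I \<psi> \<psi>1" "C1_on_I \<eta> \<eta>1" "primitive \<psi>1 (\<lambda>t. 0 - q t * \<psi> t)" "primitive \<eta>1 (\<lambda>t. 0 - q t * \<eta> t)"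
    using psi eta by (auto simp: weak_sol_def)
  define c where "c = - 1 / \<psi> 1"
  define w1 where "w1 t = c * (A t * \<eta>1 t + B t * \<psi>1 t)" for t
  have w: "w t = c * (\<eta> t * A t + \<psi> t * B t)" if t: "t \<in> I01" for t
  proof -
    have i: "(\<lambda>s. dirichlet_kernel t s * \<sigma> s) integrable_on I01"
      by (intro integrable_continuous_real continuous_intros continuous_dirichlet_kernel t \<sigma>)
    have "integral {0..t} (\<lambda>s. dirichlet_kernel t s * \<sigma> s) = integral {0..t} (\<lambda>s. c * \<eta> t * (\<psi> s * \<sigma> s))"
      by (rule integral_cong) (simp add: dirichlet_kernel_def c_def)
    moreover have "integral {t..1} (\<lambda>s. dirichlet_kernel t s * \<sigma> s) = integral {t..1} (\<lambda>s. c * \<psi> t * (\<eta> s * \<sigma> s))"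
      by (rule integral_cong) (simp add: dirichlet_kernel_def c_def)
    ultimately have "w t = c * \<eta> t * A t + c * \<psi> t * B t"
      unfolding w_def A_def B_def
      using Henstock_Kurzweil_Integration.integral_combine[OF _ _ i, of t] t by simp
    then show ?thesis by (simp add: algebra_simps)
  qed
  have cA': "continuous_on I01 A" and cB': "continuous_on I01 B"
    using cA cB by (auto intro: C1_continuous)
  have "primitive w w1"
  proof (rule primitive_cong[OF primitive_cmult[OF primitive_add[OF primitive_mult[OF C(2) pA]
            primitive_mult[OF C(1) pB]], of c]])
    fix t assume "t \<in> I01"
    show "c * (\<eta> t * A t + \<psi> t * B t) = w t" using w[OF \<open>t \<in> I01\<close>] by simp
    show "c * (\<eta>1 t * A t + \<eta> t * (\<psi> t * \<sigma> t) + (\<psi>1 t * B t + \<psi> t * (- 1 * (\<eta> t * \<sigma> t)))) = w1 t"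
      by (simp add: w1_def algebra_simps)
  qed
  moreover have "continuous_on I01 w1"
    unfolding w1_def by (intro continuous_intros cA' cB' cont)
  ultimately have "C1_on_I w w1" by (rule continuous_density_imp_C1)
  moreover have "primitive w1 (\<lambda>t. \<sigma> t - q t * w t)"
  proof (rule primitive_cong[OF primitive_cmult[OF primitive_add[OF primitive_mult[OF cA C(4)]
            primitive_mult[OF cB C(3)]], of c]])
    fix t assume t: "t \<in> I01"
    show "c * (A t * \<eta>1 t + B t * \<psi>1 t) = w1 t" by (simp add: w1_def)
    have "c * (\<psi> t * \<sigma> t * \<eta>1 t + A t * (0 - q t * \<eta> t) + (- 1 * (\<eta> t * \<sigma> t) * \<psi>1 t + B t * (0 - q t * \<psi> t)))
      = c * (\<psi> t * \<eta>1 t - \<eta> t * \<psi>1 t) * \<sigma> t - q t * (c * (\<eta> t * A t + \<psi> t * B t))"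
      by (simp add: algebra_simps)
    also have "\<dots> = \<sigma> t - q t * w t"
      using wronskian_psi_eta[OF t] psi1_pos by (simp add: w[OF t] c_def)
    finally show "c * (\<psi> t * \<sigma> t * \<eta>1 t + A t * (0 - q t * \<eta> t) + (- 1 * (\<eta> t * \<sigma> t) * \<psi>1 t + B t * (0 - q t * \<psi> t)))
      = \<sigma> t - q t * w t" .
  qed
  ultimately have "weak_sol q \<sigma> w w1" by (simp add: weak_sol_def)
  moreover have A0: "A 0 = 0" and B1: "B 1 = 0" by (auto simp: A_def B_def)
  then have "w 0 = 0" "w 1 = 0" by (simp_all add: w eta_boundary psi0)
  moreover have "w1 1 - w1 0 = integral I01 (\<lambda>s. h s * \<sigma> s)"
  proof -
    have "integral I01 (\<lambda>s. h s * \<sigma> s) = integral I01 (\<lambda>s. 1 / \<psi> 1 * (\<psi> s * \<sigma> s) + 1 / \<psi> 1 * (\<eta> s * \<sigma> s))"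
      by (rule integral_cong) (simp add: h_def algebra_simps)
    also have "\<dots> = 1 / \<psi> 1 * A 1 + 1 / \<psi> 1 * B 0"
      unfolding A_def B_def
      by (subst Henstock_Kurzweil_Integration.integral_add)
        (auto intro!: integrable_continuous_real continuous_intros cont \<sigma> simp: psi1_pos less_imp_neq[symmetric])
    finally show ?thesis
      unfolding w1_def using A0 B1 by (simp add: eta_boundary psi0 c_def)
  qed
  ultimately show ?thesis by (rule that)
qed

definition periodic_kernel where
  "periodic_kernel t s = dirichlet_kernel t s - h t * h s / (h1 1 - h1 0)"

lemma continuous_h: "continuous_on I01 h"
  using h by (auto simp: weak_sol_def intro: C1_continuous)

lemma continuous_periodic_kernel:
  assumes "t \<in> I01" shows "continuous_on I01 (periodic_kernel t)"
  unfolding periodic_kernel_def divide_inverse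
  by (intro continuous_intros continuous_dirichlet_kernel assms continuous_h)

text \<open>The correction \<open>\<gamma> h\<close> cancels the jump \<open>\<integral> h \<sigma>\<close> of the slope of the Dirichlet solution. It
  contributes the rank-one term by which the two kernels differ.\<close>

lemma periodic_solution:
  assumes \<sigma>: "continuous_on I01 \<sigma>" and D: "discriminant > 2"
  defines "w \<equiv> \<lambda>t. integral I01 (\<lambda>s. periodic_kernel t s * \<sigma> s)"
  obtains v v1 where "weak_sol q \<sigma> v v1" "v 0 = v 1" "v1 0 = v1 1" "\<And>t. t \<in> I01 \<Longrightarrow> v t = w t"
proof -
  let ?w = "\<lambda>t. integral I01 (\<lambda>s. dirichlet_kernel t s * \<sigma> s)"
  obtain w1 where w1: "weak_sol q \<sigma> ?w w1" "?w 0 = 0" "?w 1 = 0"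
    "w1 1 - w1 0 = integral I01 (\<lambda>s. h s * \<sigma> s)"
    by (rule dirichlet_solution[OF \<sigma>])
  define d where "d = h1 1 - h1 0"
  have d: "d > 0" using D psi1_pos by (simp add: d_def h_slope_jump)
  define \<gamma> where "\<gamma> = - integral I01 (\<lambda>s. h s * \<sigma> s) / d"
  show ?thesis
  proof
    show "weak_sol q \<sigma> (\<lambda>t. 1 * ?w t + \<gamma> * h t) (\<lambda>t. 1 * w1 t + \<gamma> * h1 t)"
      using weak_sol_lincomb[OF w1(1) h, of 1 \<gamma>] by simp
    show "1 * ?w 0 + \<gamma> * h 0 = 1 * ?w 1 + \<gamma> * h 1" by (simp only: w1 h_boundary)
    have "\<gamma> * d = - (w1 1 - w1 0)" unfolding \<gamma>_def w1(4) using d by simp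
    then show "1 * w1 0 + \<gamma> * h1 0 = 1 * w1 1 + \<gamma> * h1 1" by (simp add: d_def algebra_simps)
    fix t :: real assume t: "t \<in> I01"
    have "w t = integral I01 (\<lambda>s. dirichlet_kernel t s * \<sigma> s - h t / d * (h s * \<sigma> s))"
      unfolding w_def by (rule integral_cong) (simp add: periodic_kernel_def d_def algebra_simps)
    also have "\<dots> = ?w t - h t / d * integral I01 (\<lambda>s. h s * \<sigma> s)"
    proof (subst Henstock_Kurzweil_Integration.integral_diff)
      show "(\<lambda>s. dirichlet_kernel t s * \<sigma> s) integrable_on I01"
        by (intro integrable_continuous_real continuous_intros continuous_dirichlet_kernel t \<sigma>)
      show "(\<lambda>s. h t / d * (h s * \<sigma> s)) integrable_on I01"
        by (intro integrable_on_mult_right integrable_continuous_real continuous_intros continuous_h \<sigma>)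
    qed simp
    also have "\<dots> = 1 * ?w t + \<gamma> * h t" by (simp add: \<gamma>_def)
    finally show "1 * ?w t + \<gamma> * h t = w t" by simp
  qed
qed

end

text \<open>Both Green's functions are the explicit kernels, by uniqueness. They differ by
  \<open>h t h s / (h' 1 - h' 0)\<close>, which is positive when the discriminant exceeds \<open>2\<close>.\<close>

lemma (in positive_system) Green_functions_ordered:
  assumes q: "q = (\<lambda>t. a t + lam)" and D: "discriminant > 2"
    and GP: "is_Green_function a lam X_P GP" and GD: "is_Green_function a lam X_D GD"
    and t: "t \<in> {0<..<1}" and s: "s \<in> {0<..<1}"
  shows "GP t s < GD t s \<and> GD t s < 0"
proof -
  have I: "t \<in> I01" "s \<in> I01" using t s by auto
  have "GD t s = dirichlet_kernel t s"
  proof (rule Green_function_unique[OF GD _ continuous_dirichlet_kernel _ I])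
    fix \<sigma> :: "real \<Rightarrow> real" assume \<sigma>: "continuous_on I01 \<sigma>"
    let ?w = "\<lambda>t. integral I01 (\<lambda>s. dirichlet_kernel t s * \<sigma> s)"
    obtain w1 where w: "weak_sol q \<sigma> ?w w1" "?w 0 = 0" "?w 1 = 0"
      by (rule dirichlet_solution[OF \<sigma>])
    show "\<exists>w\<in>X_D. L_eq_ae a lam w \<sigma> \<and> (\<forall>t\<in>I01. w t = ?w t)"
      using weak_sol_X_D[OF w] weak_sol_L_eq_ae[OF w(1)[unfolded q]] by blast
  qed auto
  moreover have "GP t s = periodic_kernel t s"
  proof (rule Green_function_unique[OF GP _ continuous_periodic_kernel _ I])
    fix \<sigma> :: "real \<Rightarrow> real" assume \<sigma>: "continuous_on I01 \<sigma>"
    let ?w = "\<lambda>t. integral I01 (\<lambda>s. periodic_kernel t s * \<sigma> s)"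
    obtain v v1 where v: "weak_sol q \<sigma> v v1" "v 0 = v 1" "v1 0 = v1 1" "\<And>t. t \<in> I01 \<Longrightarrow> v t = ?w t"
      by (rule periodic_solution[OF \<sigma> D]) blast
    show "\<exists>w\<in>X_P. L_eq_ae a lam w \<sigma> \<and> (\<forall>t\<in>I01. w t = ?w t)"
      using weak_sol_X_P[OF v(1-3)] weak_sol_L_eq_ae[OF v(1)[unfolded q]] v(4) by blast
  qed auto
  moreover have "h t * h s / (h1 1 - h1 0) > 0"
    using h_pos I D psi1_pos by (simp add: h_slope_jump)
  ultimately show ?thesis
    using dirichlet_kernel_neg[OF t s] by (simp add: periodic_kernel_def)
qed

section \<open>Positivity below the periodic eigenvalues\<close>

text \<open>The quasi-derivative \<open>v = u' + A u\<close> absorbs the integrable coefficient: the terms with \<open>a\<close>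
  cancel in \<open>v' = (- \<mu> - m) u + A u'\<close>, which is continuous. So \<open>u v\<close> is \<open>C\<^sup>1\<close>, and substituting
  \<open>u' = v - A u\<close> in \<open>u' v + u v'\<close> leaves a sum of squares with a coefficient that is positive once
  \<open>- \<mu>\<close> is large.\<close>

lemma quasi_derivative_energy:
  fixes a A :: "real \<Rightarrow> real"
  assumes A: "primitive A (\<lambda>t. a t - m)"
    and u: "weak_sol (\<lambda>t. a t + \<mu>) (\<lambda>_. 0) u u1"
  shows "C1_on_I (\<lambda>t. u t * (u1 t + A t * u t))
     (\<lambda>t. (u1 t + A t * u t)\<^sup>2 + (- \<mu> - m - (A t)\<^sup>2) * (u t)\<^sup>2)"
proof -
  have C: "C1_on_I u u1" and p: "primitive u1 (\<lambda>t. 0 - (a t + \<mu>) * u t)" using u by (auto simp: weak_sol_def)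
  have cu: "continuous_on I01 u" "continuous_on I01 u1" "continuous_on I01 A"
    using C C1_continuous[OF C] primitive_continuous[OF A] by (auto simp: C1_on_I_def)
  have pv: "primitive (\<lambda>t. u1 t + A t * u t) (\<lambda>t. (- \<mu> - m) * u t + A t * u1 t)"
    by (rule primitive_cong[OF primitive_add[OF p primitive_mult[OF C A]]]) (simp_all add: algebra_simps)
  show ?thesis
  proof (rule continuous_density_imp_C1)
    show "primitive (\<lambda>t. u t * (u1 t + A t * u t))
     (\<lambda>t. (u1 t + A t * u t)\<^sup>2 + (- \<mu> - m - (A t)\<^sup>2) * (u t)\<^sup>2)"
      by (rule primitive_cong[OF primitive_mult[OF C pv]]) (simp_all add: algebra_simps power2_eq_square)
    show "continuous_on I01 (\<lambda>t. (u1 t + A t * u t)\<^sup>2 + (- \<mu> - m - (A t)\<^sup>2) * (u t)\<^sup>2)"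
      by (intro continuous_intros cu)
  qed
qed

lemma positive_start_imp_increase:
  fixes P p :: "real \<Rightarrow> real"
  assumes P: "C1_on_I P p" and nonneg: "\<And>t. t \<in> I01 \<Longrightarrow> p t \<ge> 0" and p0: "p 0 > 0"
    and t: "0 < t" "t \<le> 1"
  shows "P 0 < P t"
proof -
  have p: "continuous_on {0..t} p"
    using P t by (auto simp: C1_on_I_def intro: continuous_on_subset)
  have eq: "P t = P 0 + integral {0..t} p"
    by (rule primitive_eq[OF C1_imp_primitive[OF P]]) (use t in auto)
  have "integral {0..t} p \<ge> 0"
    by (rule integral_nonneg) (use p nonneg t in \<open>auto intro: integrable_continuous_real\<close>)
  moreover have "integral {0..t} p \<noteq> 0"
  proof
    assume "integral {0..t} p = 0"
    then have "(p has_integral 0) (cbox 0 t)"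
      using integrable_integral[OF integrable_continuous_real[OF p]] by simp
    then have "p 0 = 0"
      using p nonneg t by (intro has_integral_0_cbox_imp_0[of 0 t p 0]) auto
    then show False using p0 by simp
  qed
  ultimately show ?thesis using eq by simp
qed

lemma (in fundamental_system) psi_pos_near_0:
  obtains d where "d > 0" "\<And>t. 0 < t \<Longrightarrow> t < d \<Longrightarrow> t \<le> 1 \<Longrightarrow> \<psi> t > 0"
proof -
  have "(\<psi> has_real_derivative \<psi>1 0) (at 0 within I01)" using psi by (auto simp: weak_sol_def C1_on_I_def)
  then obtain d where "d > 0" "\<And>h. h > 0 \<Longrightarrow> 0 + h \<in> I01 \<Longrightarrow> h < d \<Longrightarrow> \<psi> 0 < \<psi> (0 + h)"
    using has_real_derivative_pos_inc_right[of \<psi> "\<psi>1 0" 0 I01] psi0 by auto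
  then show ?thesis using that[of d] psi0 by auto
qed

text \<open>The energy \<open>u (u' + A u)\<close> increases strictly from the left end. For \<open>\<psi>\<close> it starts at \<open>0\<close>, so
  \<open>\<psi>\<close> has no zero in \<open>(0, 1]\<close>. For \<open>h\<close> it equals \<open>h'\<close> at both ends, because \<open>A\<close> vanishes there, so
  \<open>h' 0 < h' 1\<close>, which is the claim on the discriminant.\<close>

lemma (in fundamental_system) positive_system_at_very_negative_parameter:
  assumes q: "q = (\<lambda>t. a t + \<mu>)" and A: "primitive A (\<lambda>t. a t - m)" "A 0 = 0" "A 1 = 0"
    and neg: "\<And>t. t \<in> I01 \<Longrightarrow> (A t)\<^sup>2 < - \<mu> - m"
  shows "positive_system q \<phi> \<phi>1 \<psi> \<psi>1" and "discriminant > 2"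
proof -
  have grow: "u 0 * u1 0 < u t * (u1 t + A t * u t)"
    if u: "weak_sol q (\<lambda>_. 0) u u1" and "u 0 \<noteq> 0 \<or> u1 0 \<noteq> 0" and t: "0 < t" "t \<le> 1" for u u1 t
  proof -
    have "u 0 * (u1 0 + A 0 * u 0) < u t * (u1 t + A t * u t)"
    proof (rule positive_start_imp_increase[OF quasi_derivative_energy[OF A(1) u[unfolded q]] _ _ t])
      show "(u1 s + A s * u s)\<^sup>2 + (- \<mu> - m - (A s)\<^sup>2) * (u s)\<^sup>2 \<ge> 0" if "s \<in> I01" for s
        using neg[OF that] by (intro add_nonneg_nonneg mult_nonneg_nonneg) auto
      have k: "- \<mu> - m > 0" using neg[of 0] A(2) by simp
      show "(u1 0 + A 0 * u 0)\<^sup>2 + (- \<mu> - m - (A 0)\<^sup>2) * (u 0)\<^sup>2 > 0"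
      proof (cases "u 0 = 0")
        case True
        then show ?thesis using \<open>u 0 \<noteq> 0 \<or> u1 0 \<noteq> 0\<close> by simp
      next
        case False
        then have "(- \<mu> - m) * (u 0)\<^sup>2 > 0" using k by simp
        then show ?thesis using A(2) by (simp add: add_nonneg_pos)
      qed
    qed
    then show ?thesis using A(2) by simp
  qed
  have nz: "\<psi> t \<noteq> 0" if "0 < t" "t \<le> 1" for t
    using grow[OF psi _ that] psi0 by auto
  obtain d where d: "d > 0" "\<And>t. 0 < t \<Longrightarrow> t < d \<Longrightarrow> t \<le> 1 \<Longrightarrow> \<psi> t > 0"
    by (rule psi_pos_near_0) blast
  have pos: "\<psi> t > 0" if t: "0 < t" "t \<le> 1" for t
  proof (rule ccontr)
    assume neg: "\<not> \<psi> t > 0"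
    define s where "s = min (d / 2) t"
    have s: "0 < s" "s \<le> t" "\<psi> s > 0" using d(1) d(2)[of s] t by (auto simp: s_def)
    have "continuous_on {s..t} \<psi>"
      by (rule continuous_on_subset[OF continuous_fundamental(1)]) (use s t in auto)
    then obtain x where "s \<le> x" "x \<le> t" "\<psi> x = 0"
      using IVT2'[of \<psi> t 0 s] neg s by auto
    then show False using nz[of x] s t by simp
  qed
  then show ps: "positive_system q \<phi> \<phi>1 \<psi> \<psi>1" by unfold_locales
  interpret ps: positive_system q \<phi> \<phi>1 \<psi> \<psi>1 by (rule ps)
  have "ps.h1 0 < ps.h1 1" using grow[OF ps.h, of 1] A(3) by (simp add: ps.h_boundary)
  then have "(discriminant - 2) / \<psi> 1 > 0" using ps.h_slope_jump by simp
  then show "discriminant > 2" using ps.psi1_pos by (simp add: zero_less_divide_iff)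
qed

text \<open>Subtracting the mean of \<open>a\<close> makes the primitive vanish at both ends, so that the
  quasi-derivative \<open>u' + A u\<close> agrees with \<open>u'\<close> there.\<close>

lemma mean_free_primitive:
  assumes a: "a absolutely_integrable_on I01"
  obtains A m where "primitive A (\<lambda>t. a t - m)" "A 0 = 0" "A 1 = 0"
proof -
  define m where "m = integral I01 a"
  have f: "(\<lambda>t. a t - m) absolutely_integrable_on I01"
    by (intro set_integral_diff a abs_int_continuous continuous_intros)
  have "integral I01 (\<lambda>t. a t - m) = 0"
    using a by (subst Henstock_Kurzweil_Integration.integral_diff) (auto simp: m_def absolutely_integrable_on_def)
  then show ?thesis
    using that[of "\<lambda>t. 0 + integral {0..t} (\<lambda>t. a t - m)" m] primitive_integral[OF f, of 0] by simp
qed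

lemma fundamental_family_exists:
  fixes a :: "real \<Rightarrow> real"
  assumes a: "a absolutely_integrable_on I01" and R: "R \<ge> 0"
  obtains \<phi> \<phi>1 \<psi> \<psi>1 :: "real \<Rightarrow> real \<Rightarrow> real" where
    "\<And>\<mu>. \<mu> \<in> {-R..R} \<Longrightarrow> fundamental_system (\<lambda>t. a t + \<mu>) (\<phi> \<mu>) (\<phi>1 \<mu>) (\<psi> \<mu>) (\<psi>1 \<mu>)"
    "continuous_on ({-R..R} \<times> I01) (\<lambda>(\<mu>, t). \<phi> \<mu> t)"
    "continuous_on ({-R..R} \<times> I01) (\<lambda>(\<mu>, t). \<psi> \<mu> t)"
    "\<And>\<mu> t. \<mu> \<in> {-R..R} \<Longrightarrow> t \<in> I01 \<Longrightarrow>
       \<psi> \<mu> t = t - integral {0..t} (\<lambda>s. (t - s) * ((a s + \<mu>) * \<psi> \<mu> s))"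
    "\<And>\<mu>. \<psi>1 \<mu> 1 = 1 - integral I01 (\<lambda>s. (a s + \<mu>) * \<psi> \<mu> s)"
proof -
  obtain \<phi> :: "real \<Rightarrow> real \<Rightarrow> real" where \<phi>: "continuous_on ({-R..R} \<times> I01) (\<lambda>(\<mu>, t). \<phi> \<mu> t)"
    "\<And>\<mu> t. \<mu> \<in> {-R..R} \<Longrightarrow> t \<in> I01 \<Longrightarrow>
       \<phi> \<mu> t = 1 + 0 * t - integral {0..t} (\<lambda>s. (t - s) * ((a s + \<mu>) * \<phi> \<mu> s))"
    using volterra_solution_exists[OF a R, of 1 0] by blast
  obtain \<psi> :: "real \<Rightarrow> real \<Rightarrow> real" where \<psi>: "continuous_on ({-R..R} \<times> I01) (\<lambda>(\<mu>, t). \<psi> \<mu> t)"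
    "\<And>\<mu> t. \<mu> \<in> {-R..R} \<Longrightarrow> t \<in> I01 \<Longrightarrow>
       \<psi> \<mu> t = 0 + 1 * t - integral {0..t} (\<lambda>s. (t - s) * ((a s + \<mu>) * \<psi> \<mu> s))"
    using volterra_solution_exists[OF a R, of 0 1] by blast
  define \<phi>1 where "\<phi>1 \<mu> t = 0 - integral {0..t} (\<lambda>s. (a s + \<mu>) * \<phi> \<mu> s)" for \<mu> t
  define \<psi>1 where "\<psi>1 \<mu> t = 1 - integral {0..t} (\<lambda>s. (a s + \<mu>) * \<psi> \<mu> s)" for \<mu> t
  show ?thesis
  proof (rule that[of \<phi> \<phi>1 \<psi> \<psi>1])
    fix \<mu> assume \<mu>: "\<mu> \<in> {-R..R}"
    have q: "(\<lambda>t. a t + \<mu>) absolutely_integrable_on I01"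
      by (intro set_integral_add a abs_int_continuous continuous_intros)
    have "weak_sol (\<lambda>t. a t + \<mu>) (\<lambda>_. 0) (\<phi> \<mu>) (\<phi>1 \<mu>)"
      unfolding \<phi>1_def[abs_def] by (rule volterra_imp_weak_sol[OF q continuous_on_section[OF \<phi>(1) \<mu>] \<phi>(2)[OF \<mu>]])
    moreover have "weak_sol (\<lambda>t. a t + \<mu>) (\<lambda>_. 0) (\<psi> \<mu>) (\<psi>1 \<mu>)"
      unfolding \<psi>1_def[abs_def] by (rule volterra_imp_weak_sol[OF q continuous_on_section[OF \<psi>(1) \<mu>] \<psi>(2)[OF \<mu>]])
    moreover have "\<phi> \<mu> 0 = 1" "\<psi> \<mu> 0 = 0" using \<phi>(2)[OF \<mu>, of 0] \<psi>(2)[OF \<mu>, of 0] by auto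
    ultimately show "fundamental_system (\<lambda>t. a t + \<mu>) (\<phi> \<mu>) (\<phi>1 \<mu>) (\<psi> \<mu>) (\<psi>1 \<mu>)"
      by unfold_locales (auto simp: \<phi>1_def \<psi>1_def)
    fix t :: real assume "t \<in> I01"
    then show "\<psi> \<mu> t = t - integral {0..t} (\<lambda>s. (t - s) * ((a s + \<mu>) * \<psi> \<mu> s))"
      using \<psi>(2)[OF \<mu>, of t] by simp
  qed (use \<phi> \<psi> in \<open>simp_all add: \<psi>1_def\<close>)
qed

text \<open>The Volterra equation gives \<open>\<bar>\<psi> \<mu> t - t\<bar> \<le> t C \<integral>\<^sub>0\<^sup>t (\<bar>a\<bar> + R)\<close>, and the integral is small
  for small \<open>t\<close>, independently of \<open>\<mu>\<close>. So zeros of \<open>\<psi> \<mu>\<close> cannot escape to \<open>0\<close> as \<open>\<mu>\<close> varies.\<close>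

lemma uniformly_positive_near_0:
  fixes a :: "real \<Rightarrow> real" and \<psi> :: "real \<Rightarrow> real \<Rightarrow> real"
  assumes a: "a absolutely_integrable_on I01"
    and cont: "continuous_on ({-R..R} \<times> I01) (\<lambda>(\<mu>, t). \<psi> \<mu> t)"
    and eq: "\<And>\<mu> t. \<mu> \<in> {-R..R} \<Longrightarrow> t \<in> I01 \<Longrightarrow>
       \<psi> \<mu> t = t - integral {0..t} (\<lambda>s. (t - s) * ((a s + \<mu>) * \<psi> \<mu> s))"
  obtains \<delta> where "\<delta> > 0" "\<And>\<mu> t. \<mu> \<in> {-R..R} \<Longrightarrow> 0 < t \<Longrightarrow> t \<le> 1 \<Longrightarrow> t < \<delta> \<Longrightarrow> \<psi> \<mu> t > 0"
proof -
  obtain C where C: "C > 0" "\<And>\<mu> t. \<mu> \<in> {-R..R} \<Longrightarrow> t \<in> I01 \<Longrightarrow> \<bar>\<psi> \<mu> t\<bar> \<le> C"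
    using continuous_on_rectangle_bounded[OF cont] by blast
  let ?p = "\<lambda>s. C * (\<bar>a s\<bar> + R)"
  have aabs: "(\<lambda>s. \<bar>a s\<bar>) absolutely_integrable_on I01"
    by (rule abs_int_abs[OF a])
  have p: "?p absolutely_integrable_on I01"
    by (intro abs_int_continuous_mult set_integral_add aabs abs_int_continuous continuous_intros)
  have "continuous_on I01 (\<lambda>t. integral {0..t} ?p)"
    using primitive_continuous[OF primitive_integral[OF p, of 0]] by simp
  then obtain \<delta> where \<delta>: "\<delta> > 0" "\<And>t. t \<in> I01 \<Longrightarrow> dist t 0 < \<delta> \<Longrightarrow> dist (integral {0..t} ?p) (integral {0..0} ?p) < 1"
    unfolding continuous_on_iff by (metis atLeastAtMost_iff order_refl zero_le_one zero_less_one)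
  show ?thesis
  proof (rule that[OF \<delta>(1)])
    fix \<mu> t :: real assume \<mu>: "\<mu> \<in> {-R..R}" and t: "0 < t" "t \<le> 1" "t < \<delta>"
    have small: "integral {0..t} ?p < 1" using \<delta>(2)[of t] t by (simp add: dist_real_def)
    have pt: "?p integrable_on {0..t}" by (rule integrable_subinterval_I01[OF p]) (use t in auto)
    have sl: "continuous_on I01 (\<psi> \<mu>)" by (rule continuous_on_section[OF cont \<mu>])
    have "(\<lambda>s. ((t - s) * \<psi> \<mu> s) * (a s + \<mu>)) absolutely_integrable_on I01"
      by (intro abs_int_continuous_mult set_integral_add a abs_int_continuous continuous_intros sl)
    then have f: "(\<lambda>s. (t - s) * ((a s + \<mu>) * \<psi> \<mu> s)) integrable_on {0..t}"
      using t by (intro integrable_subinterval_I01) (auto simp: mult_ac)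
    have "\<bar>integral {0..t} (\<lambda>s. (t - s) * ((a s + \<mu>) * \<psi> \<mu> s))\<bar> \<le> integral {0..t} (\<lambda>s. t * ?p s)"
    proof (rule abs_integral_bound[OF f integrable_on_mult_right[OF pt]])
      fix s assume s: "s \<in> {0..t}"
      have "\<bar>(a s + \<mu>) * \<psi> \<mu> s\<bar> \<le> (\<bar>a s\<bar> + R) * C"
        unfolding abs_mult using C(2)[OF \<mu>, of s] \<mu> s t by (intro mult_mono) auto
      then show "\<bar>(t - s) * ((a s + \<mu>) * \<psi> \<mu> s)\<bar> \<le> t * (C * (\<bar>a s\<bar> + R))"
        unfolding abs_mult[of "t - s"] using s by (intro mult_mono) (auto simp: mult.commute)
    qed
    also have "\<dots> = t * integral {0..t} ?p" by (rule Henstock_Kurzweil_Integration.integral_mult_right)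
    also have "\<dots> < t * 1" using small t by (intro mult_strict_left_mono)
    finally show "\<psi> \<mu> t > 0" using eq[OF \<mu>, of t] t by auto
  qed
qed

text \<open>Start at a very negative \<open>\<mu>0\<close> and increase the parameter. The discriminant cannot cross \<open>2\<close>,
  since that would give a periodic eigenvalue. At the least parameter at which \<open>\<psi>\<close> has a zero in
  \<open>(0, 1]\<close>, \<open>\<psi>\<close> would still be nonnegative as a limit of positive functions, so the discriminant
  would be negative there.\<close>

lemma positive_system_below_periodic_eigenvalues:
  fixes a :: "real \<Rightarrow> real"
  assumes a: "a absolutely_integrable_on I01"
    and none: "\<And>\<mu>. \<mu> \<le> lam \<Longrightarrow> \<not> is_eigenvalue a X_P \<mu>"
  obtains \<phi> \<phi>1 \<psi> \<psi>1 where "positive_system (\<lambda>t. a t + lam) \<phi> \<phi>1 \<psi> \<psi>1"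
    "fundamental_system.discriminant \<phi> \<psi>1 > 2"
proof -
  obtain A m where A: "primitive A (\<lambda>t. a t - m)" "A 0 = 0" "A 1 = 0"
    by (rule mean_free_primitive[OF a])
  have "bounded (A ` I01)" by (intro compact_imp_bounded compact_continuous_image primitive_continuous[OF A(1)]) auto
  then obtain M where M: "M > 0" "\<And>t. t \<in> I01 \<Longrightarrow> \<bar>A t\<bar> \<le> M" by (force simp: bounded_pos)
  \<comment> \<open>Subtracting \<open>1\<close> makes the inequalities \<open>\<mu>0 < lam\<close> and \<open>A\<^sup>2 < - \<mu>0 - m\<close> strict.\<close>
  define \<mu>0 where "\<mu>0 = min (lam - 1) (- m - M\<^sup>2 - 1)"
  have neg: "(A t)\<^sup>2 < - \<mu>0 - m" if "t \<in> I01" for t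
  proof -
    have "(A t)\<^sup>2 \<le> M\<^sup>2" using M(2)[OF that] M(1) by (simp add: abs_le_square_iff[symmetric])
    then show ?thesis by (simp add: \<mu>0_def)
  qed
  have \<mu>0: "\<mu>0 < lam" by (simp add: \<mu>0_def)
  define R where "R = max \<bar>\<mu>0\<bar> \<bar>lam\<bar>"
  have R: "R \<ge> 0" and sub: "{\<mu>0..lam} \<subseteq> {-R..R}" by (auto simp: R_def)
  obtain \<phi> \<phi>1 \<psi> \<psi>1 :: "real \<Rightarrow> real \<Rightarrow> real" where
    fs: "\<And>\<mu>. \<mu> \<in> {-R..R} \<Longrightarrow> fundamental_system (\<lambda>t. a t + \<mu>) (\<phi> \<mu>) (\<phi>1 \<mu>) (\<psi> \<mu>) (\<psi>1 \<mu>)"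
    and c\<phi>: "continuous_on ({-R..R} \<times> I01) (\<lambda>(\<mu>, t). \<phi> \<mu> t)"
    and c\<psi>: "continuous_on ({-R..R} \<times> I01) (\<lambda>(\<mu>, t). \<psi> \<mu> t)"
    and eq: "\<And>\<mu> t. \<mu> \<in> {-R..R} \<Longrightarrow> t \<in> I01 \<Longrightarrow>
       \<psi> \<mu> t = t - integral {0..t} (\<lambda>s. (t - s) * ((a s + \<mu>) * \<psi> \<mu> s))"
    and \<psi>1: "\<And>\<mu>. \<psi>1 \<mu> 1 = 1 - integral I01 (\<lambda>s. (a s + \<mu>) * \<psi> \<mu> s)"
    by (rule fundamental_family_exists[OF a R]) blast
  let ?\<Delta> = "\<lambda>\<mu>. fundamental_system.discriminant (\<phi> \<mu>) (\<psi>1 \<mu>)"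
  have \<Delta>: "?\<Delta> \<mu> = \<phi> \<mu> 1 + \<psi>1 \<mu> 1" if "\<mu> \<in> {-R..R}" for \<mu>
    by (rule fundamental_system.discriminant_def[OF fs[OF that]])
  have slice: "continuous_on {-R..R} (\<lambda>\<mu>. u \<mu> t)"
    if "continuous_on ({-R..R} \<times> I01) (\<lambda>(\<mu>, t). u \<mu> t)" "t \<in> I01" for u :: "real \<Rightarrow> real \<Rightarrow> real" and t
  proof -
    have "continuous_on {-R..R} (\<lambda>\<mu>. (\<lambda>(\<mu>, t). u \<mu> t) (\<mu>, t))"
      by (rule continuous_on_compose2[OF that(1)]) (use that in \<open>auto intro!: continuous_intros\<close>)
    then show ?thesis by simp
  qed
  have "continuous_on {-R..R} ?\<Delta>"
  proof -
    obtain C where C: "\<And>\<mu> t. \<mu> \<in> {-R..R} \<Longrightarrow> t \<in> I01 \<Longrightarrow> \<bar>\<psi> \<mu> t\<bar> \<le> C"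
      using continuous_on_rectangle_bounded[OF c\<psi>] by blast
    have 1: "continuous_on {-R..R} (\<lambda>\<mu>. integral I01 (\<lambda>s. \<psi> \<mu> s * a s))"
      by (rule continuous_on_weighted_integral[OF a c\<psi> C])
    have 2: "continuous_on {-R..R} (\<lambda>\<mu>. integral I01 (\<lambda>s. \<psi> \<mu> s * 1))"
      by (rule continuous_on_weighted_integral[OF abs_int_continuous c\<psi> C]) (intro continuous_intros)
    have "continuous_on {-R..R} (\<lambda>\<mu>. \<phi> \<mu> 1 + (1 - (integral I01 (\<lambda>s. \<psi> \<mu> s * a s) + \<mu> * integral I01 (\<lambda>s. \<psi> \<mu> s * 1))))"
      by (intro continuous_intros 1 2 slice[OF c\<phi>]) auto
    moreover have "\<phi> \<mu> 1 + (1 - (integral I01 (\<lambda>s. \<psi> \<mu> s * a s) + \<mu> * integral I01 (\<lambda>s. \<psi> \<mu> s * 1))) = ?\<Delta> \<mu>"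
      if \<mu>: "\<mu> \<in> {-R..R}" for \<mu>
    proof -
      interpret fundamental_system "\<lambda>t. a t + \<mu>" "\<phi> \<mu>" "\<phi>1 \<mu>" "\<psi> \<mu>" "\<psi>1 \<mu>" by (rule fs[OF \<mu>])
      have "integral I01 (\<lambda>s. (a s + \<mu>) * \<psi> \<mu> s) = integral I01 (\<lambda>s. \<psi> \<mu> s * a s + \<mu> * (\<psi> \<mu> s * 1))"
        by (rule integral_cong) (simp add: algebra_simps)
      also have "\<dots> = integral I01 (\<lambda>s. \<psi> \<mu> s * a s) + integral I01 (\<lambda>s. \<mu> * (\<psi> \<mu> s * 1))"
      proof (rule Henstock_Kurzweil_Integration.integral_add)
        show "(\<lambda>s. \<psi> \<mu> s * a s) integrable_on I01"
          using abs_int_continuous_mult[OF a continuous_fundamental(1)] by (simp add: absolutely_integrable_on_def)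
        show "(\<lambda>s. \<mu> * (\<psi> \<mu> s * 1)) integrable_on I01"
          by (intro integrable_continuous_real continuous_intros continuous_fundamental(1))
      qed
      finally show ?thesis by (simp add: \<psi>1 discriminant_def)
    qed
    ultimately show ?thesis by (rule continuous_on_eq)
  qed
  then have c\<Delta>: "continuous_on {\<mu>0..\<mu>} ?\<Delta>" if "\<mu> \<le> lam" for \<mu>
    by (rule continuous_on_subset) (use that sub in auto)
  have start: "positive_system (\<lambda>t. a t + \<mu>0) (\<phi> \<mu>0) (\<phi>1 \<mu>0) (\<psi> \<mu>0) (\<psi>1 \<mu>0)" "?\<Delta> \<mu>0 > 2"
    using fundamental_system.positive_system_at_very_negative_parameter[OF fs refl A neg] sub \<mu>0 by auto
  have \<Delta>2: "?\<Delta> \<mu> > 2" if \<mu>: "\<mu> \<in> {\<mu>0..lam}" for \<mu>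
  proof (rule ccontr)
    assume "\<not> ?\<Delta> \<mu> > 2"
    then obtain \<nu> where \<nu>: "\<mu>0 \<le> \<nu>" "\<nu> \<le> \<mu>" "?\<Delta> \<nu> = 2"
      using IVT2'[of ?\<Delta> \<mu> 2 \<mu>0] c\<Delta>[of \<mu>] start(2) \<mu> by auto
    then have \<nu>': "\<nu> \<in> {-R..R}" "\<nu> \<le> lam" using sub \<mu> by auto
    obtain u u1 where "weak_sol (\<lambda>t. a t + \<nu>) (\<lambda>_. 0) u u1" "u \<in> X_P" "\<exists>t\<in>I01. u t \<noteq> 0"
      using fundamental_system.discriminant_2_imp_periodic_solution[OF fs[OF \<nu>'(1)] \<nu>(3)] by blast
    then have "is_eigenvalue a X_P \<nu>" unfolding is_eigenvalue_def using weak_sol_L_eq_ae by blast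
    then show False using none \<nu>' by blast
  qed
  obtain \<delta> where \<delta>: "\<delta> > 0" "\<And>\<mu> t. \<mu> \<in> {-R..R} \<Longrightarrow> 0 < t \<Longrightarrow> t \<le> 1 \<Longrightarrow> t < \<delta> \<Longrightarrow> \<psi> \<mu> t > 0"
    by (rule uniformly_positive_near_0[OF a c\<psi> eq]) blast+
  \<comment> \<open>Parameters and points at which positivity fails. The bound \<open>min \<delta> 1\<close> keeps the rectangle away from \<open>t = 0\<close>,
    where \<open>\<psi> \<mu>\<close> vanishes for every \<open>\<mu>\<close>.\<close>
  define Z where "Z = ({\<mu>0..lam} \<times> {min \<delta> 1..1}) \<inter> (\<lambda>(\<mu>, t). \<psi> \<mu> t) -` {..0}"
  have "Z = {}"
  proof (rule ccontr)
    assume "Z \<noteq> {}"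
    have "closed Z"
      unfolding Z_def
      by (intro continuous_closed_preimage continuous_on_subset[OF c\<psi>] closed_Times)
        (use sub \<delta> in auto)
    then have "compact (({\<mu>0..lam} \<times> {min \<delta> 1..1}) \<inter> Z)"
      by (intro compact_Int_closed compact_Times compact_Icc)
    moreover have "({\<mu>0..lam} \<times> {min \<delta> 1..1}) \<inter> Z = Z" by (auto simp: Z_def)
    ultimately have "compact Z" by simp
    then have "compact (fst ` Z)" by (intro compact_continuous_image continuous_intros)
    then obtain m where m: "m \<in> fst ` Z" "\<And>\<mu>. \<mu> \<in> fst ` Z \<Longrightarrow> m \<le> \<mu>"
      using compact_attains_inf[of "fst ` Z"] \<open>Z \<noteq> {}\<close> by auto
    then obtain \<tau> where \<tau>: "m \<in> {\<mu>0..lam}" "\<tau> \<in> {min \<delta> 1..1}" "\<psi> m \<tau> \<le> 0" by (auto simp: Z_def)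
    have \<tau>0: "0 < \<tau>" "\<tau> \<le> 1" using \<tau>(2) \<delta>(1) by auto
    have mR: "m \<in> {-R..R}" using \<tau>(1) sub by auto
    interpret m: fundamental_system "\<lambda>t. a t + m" "\<phi> m" "\<phi>1 m" "\<psi> m" "\<psi>1 m" by (rule fs[OF mR])
    have "m \<noteq> \<mu>0"
      using positive_system.psi_pos[OF start(1) \<tau>0] \<tau>(3) by auto
    then have m0: "\<mu>0 < m" using \<tau>(1) by simp
    have nonneg: "\<psi> m t \<ge> 0" if t: "t \<in> I01" for t
    proof (cases "t = 0")
      case True
      then show ?thesis by (simp add: m.psi0)
    next
      case False
      have before: "\<psi> \<mu> t \<ge> 0" if \<mu>: "\<mu> \<in> {\<mu>0..<m}" for \<mu>
      proof (rule ccontr)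
        assume neg: "\<not> \<psi> \<mu> t \<ge> 0"
        then have "\<not> t < \<delta>" using \<delta>(2)[of \<mu> t] \<mu> \<tau>(1) sub t False by force
        then have "(\<mu>, t) \<in> Z" using neg \<mu> \<tau>(1) t by (auto simp: Z_def)
        then have "m \<le> \<mu>" using m(2)[of \<mu>] by force
        then show False using \<mu> by simp
      qed
      have cl: "closure {\<mu>0..<m} = {\<mu>0..m}" using m0 by simp
      show ?thesis
      proof (rule continuous_ge_on_closure[of "{\<mu>0..<m}" "\<lambda>\<mu>. \<psi> \<mu> t" m 0])
        show "continuous_on (closure {\<mu>0..<m}) (\<lambda>\<mu>. \<psi> \<mu> t)"
          unfolding cl by (rule continuous_on_subset[OF slice[OF c\<psi> t]]) (use \<tau>(1) sub in auto)
      qed (use before m0 cl in auto)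
    qed
    have "\<psi> m \<tau> = 0" using nonneg[of \<tau>] \<tau>(3) \<tau>0 by simp
    then have "?\<Delta> m < 0" using m.first_zero_imp_discriminant_neg[OF nonneg \<tau>0] by simp
    then show False using \<Delta>2[OF \<tau>(1)] by simp
  qed
  have lamI: "lam \<in> {\<mu>0..lam}" using \<mu>0 by simp
  then have lamR: "lam \<in> {-R..R}" using sub by blast
  interpret l: fundamental_system "\<lambda>t. a t + lam" "\<phi> lam" "\<phi>1 lam" "\<psi> lam" "\<psi>1 lam" by (rule fs[OF lamR])
  have "\<psi> lam t > 0" if t: "0 < t" "t \<le> 1" for t
  proof (rule ccontr)
    assume neg: "\<not> \<psi> lam t > 0"
    then have "\<not> t < \<delta>" using \<delta>(2)[OF lamR t] by blast
    then have "(lam, t) \<in> Z" using neg lamI t by (auto simp: Z_def)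
    then show False using \<open>Z = {}\<close> by blast
  qed
  then have "positive_system (\<lambda>t. a t + lam) (\<phi> lam) (\<phi>1 lam) (\<psi> lam) (\<psi>1 lam)" by unfold_locales
  then show ?thesis using \<Delta>2[OF lamI] that by blast
qed

theorem theorem3p8:
  fixes a :: "real \<Rightarrow> real" and lam0P lam :: real and G\<^sub>P G\<^sub>D :: "real \<Rightarrow> real \<Rightarrow> real"
  assumes "a absolutely_integrable_on I01"
    and "is_first_eigenvalue a X_P lam0P"
    and "lam < lam0P"
    and "is_Green_function a lam X_P G\<^sub>P"
    and "is_Green_function a lam X_D G\<^sub>D"
  shows "\<forall>t\<in>{0<..<1}. \<forall>s\<in>{0<..<1}. G\<^sub>P t s < G\<^sub>D t s \<and> G\<^sub>D t s < 0"
proof (intro ballI)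
  fix t s :: real assume t: "t \<in> {0<..<1}" and s: "s \<in> {0<..<1}"
  have none: "\<not> is_eigenvalue a X_P \<mu>" if "\<mu> \<le> lam" for \<mu>
    using assms(2,3) that unfolding is_first_eigenvalue_def by force
  obtain \<phi> \<phi>1 \<psi> \<psi>1 where ps: "positive_system (\<lambda>t. a t + lam) \<phi> \<phi>1 \<psi> \<psi>1"
    and D: "fundamental_system.discriminant \<phi> \<psi>1 > 2"
    by (rule positive_system_below_periodic_eigenvalues[OF assms(1) none])
  show "G\<^sub>P t s < G\<^sub>D t s \<and> G\<^sub>D t s < 0"
    by (rule positive_system.Green_functions_ordered[OF ps refl D assms(4,5) t s])
qed

end
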